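(* Let $m,k\ge 0$ and $\alpha_1,\ldots,\alpha_m\ge 2$, $\beta_1,\ldots,\beta_k\ge 1$ be integers, let $n=\sum_{j=1}^m\alpha_j+\sum_{i=1}^k\beta_i$ and $M=\sum_{j=1}^m\alpha_j$, and let $\mathcal M$ be the subset of $M_n(\mathbb K)$ consisting of all matrices $B$ with pairwise different eigenvalues $\lambda_1,\ldots,\lambda_m,\mu_1,\ldots,\mu_k$ (not fixed in advance) of (algebraic) multiplicities $\alpha_1,\ldots,\alpha_m,\beta_1,\ldots,\beta_k$, correspondingly, satisfying the conditions $$\dim\ker(B-\lambda_iI)>1,\ 1\le i\le m,\quad\text{and}\quad \dim\ker(B-\mu_jI)=1,\ 1\le j\le k.$$ Then the following statements are true. 1. If $m\le 1$, then all matrices in $\mathcal M$ are integrable. 2. If $2\le m\le n-M+1$, then $\mathcal M$ contains both integrable and non-integrable matrices. 3. If $m>n-M+1$, then all matrices in $\mathcal M$ are non-integrable. In particular, $\mathcal M$ contains an integrable matrix if and only if $m\le n-M+1$.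
   Context: $\mathbb K$ is an algebraically closed subfield of $\mathbb C$; $M_n(\mathbb K)$ is the set of $n\times n$ matrices over $\mathbb K$; $\mathbb K^n$ is the set of row vectors of length $n$. For a square matrix $X$, $p_X(x)=\det(xI-X)$ is its characteristic polynomial. For $B\in M_n(\mathbb K)$, a matrix $A\in M_{n+1}(\mathbb K)$ is called an integral of $B$ if there exist $u,v\in\mathbb K^n$ and $b\in\mathbb K$ such that $A=\begin{pmatrix} B & u^{\top}\\ v & b\end{pmatrix}$ and $p_B(x)=\frac{1}{n+1}p_A'(x)$. The matrix $B$ is integrable if there exists an integral of $B$. *)

theory Defs
  imports
    "HOL-Computational_Algebra.Fundamental_Theorem_Algebra"
    "Jordan_Normal_Form.Char_Poly"
    "Jordan_Normal_Form.Matrix_Kernel"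
begin

(* The ground field is a type 'a of class alg_closed_field.  That it is a subfield of the complex
   numbers is expressed by a field homomorphism (hence an embedding) from 'a to complex. *)

definition integral_of_mat :: "nat \<Rightarrow> 'a :: field mat \<Rightarrow> 'a mat \<Rightarrow> bool" where
  "integral_of_mat n B A \<longleftrightarrow>
     (\<exists>u \<in> carrier_vec n. \<exists>v \<in> carrier_vec n. \<exists>b.
        A = four_block_mat B (transpose_mat (mat_of_row u)) (mat_of_row v) (mat 1 1 (\<lambda>_. b))) \<and>
     char_poly B = Polynomial.smult (1 / of_nat (n + 1)) (pderiv (char_poly A))"

definition integrable_mat :: "nat \<Rightarrow> 'a :: field mat \<Rightarrow> bool" where
  "integrable_mat n B \<longleftrightarrow> (\<exists>A \<in> carrier_mat (n + 1) (n + 1). integral_of_mat n B A)"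

(* The eigenvalues are existentially quantified, so they are not fixed in advance.  If n is the
   sum of all \<alpha> j and \<beta> i, the prescribed multiplicities exhaust the degree of the characteristic
   polynomial, so lam and mu list all eigenvalues of B. *)
definition eigen_class ::
  "nat \<Rightarrow> nat \<Rightarrow> (nat \<Rightarrow> nat) \<Rightarrow> nat \<Rightarrow> (nat \<Rightarrow> nat) \<Rightarrow> 'a :: field mat set" where
  "eigen_class n m \<alpha> k \<beta> =
     {B \<in> carrier_mat n n. \<exists>lam mu.
        inj_on lam {1..m} \<and> inj_on mu {1..k} \<and> lam ` {1..m} \<inter> mu ` {1..k} = {} \<and>
        (\<forall>j\<in>{1..m}. eigenvalue B (lam j) \<and> Polynomial.order (lam j) (char_poly B) = \<alpha> j \<and>
                    kernel_dim (B - lam j \<cdot>\<^sub>m 1\<^sub>m n) > 1) \<and>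
        (\<forall>i\<in>{1..k}. eigenvalue B (mu i) \<and> Polynomial.order (mu i) (char_poly B) = \<beta> i \<and>
                    kernel_dim (B - mu i \<cdot>\<^sub>m 1\<^sub>m n) = 1)}"

end

theory Submission
  imports
    Defs
    "HOL-Computational_Algebra.Formal_Laurent_Series"
    "HOL-Computational_Algebra.Polynomial_FPS"
    "Jordan_Normal_Form.Jordan_Normal_Form_Uniqueness"
begin

text \<open>
  The characteristic polynomial of a bordered matrix is \<open>(x - b) p - r u\<close>, where \<open>p\<close> is the
  characteristic polynomial of \<open>B\<close> and the row \<open>r\<close> satisfies \<open>r (x I - B) = p v\<close>. It vanishes at
  every \<open>\<lambda>\<^sub>j\<close>, as \<open>ker (B - \<lambda>\<^sub>j I)\<close> meets the hyperplane \<open>v x = 0\<close>. Modulo \<open>p\<close> the polynomials \<open>r u\<close>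
  form an ideal, and for generic \<open>v\<close> its generator does not vanish at any \<open>\<mu>\<^sub>i\<close>. Hence \<open>B\<close> is
  integrable if and only if some antiderivative \<open>P\<close> of \<open>(n + 1) p\<close> vanishes at all \<open>\<lambda>\<^sub>j\<close>. Such a
  \<open>P\<close> has a zero of order \<open>\<alpha>\<^sub>j + 1\<close> at \<open>\<lambda>\<^sub>j\<close>, and comparing degrees gives \<open>m \<le> n - M + 1\<close>.

  Conversely, put \<open>N = n - M + 1\<close>. We need \<open>P = \<Prod> (x - s\<^sub>r)^w\<^sub>r\<close> with \<open>N\<close> distinct zeros of
  multiplicities \<open>\<alpha>\<^sub>j + 1\<close> and \<open>1\<close> such that the quotient of its derivative by
  \<open>\<Prod> (x - s\<^sub>r)^(w\<^sub>r - 1)\<close> is \<open>d \<Prod> (x - \<mu>\<^sub>i)^\<beta>\<^sub>i\<close>. If all weights \<open>w\<^sub>r\<close> are \<open>1\<close> and \<open>s\<^sub>r = r\<close>,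
  then the map from the \<open>s\<^sub>r\<close> with \<open>s\<^sub>0 = 0\<close> to this quotient has an invertible derivative. So when
  weights and quotient are deformed linearly in a formal parameter \<open>z\<close>, there is a solution over
  \<open>K[[z]]\<close>, and a place of \<open>K((z))\<close> extending \<open>z \<mapsto> 1\<close> specialises it to \<open>K\<close>. The place is finite
  on the \<open>s\<^sub>r\<close>: otherwise rescaling would give \<open>s\<^sub>r\<close>, not all \<open>0\<close>, with \<open>s\<^sub>0 = 0\<close> and quotient
  \<open>d x^(N - 1)\<close>, but a zero at which \<open>e\<close> of the \<open>s\<^sub>r\<close> coincide is a zero of order \<open>e - 1\<close> of the
  quotient. For the same reason, and by compactness in \<open>\<complex>\<close>, no \<open>s\<^sub>r\<close> equals a \<open>\<mu>\<^sub>i\<close> if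
  \<open>s\<^sub>0 = 0\<close> and the \<open>\<mu>\<^sub>i\<close> are close to each other and far from \<open>0\<close>; the \<open>s\<^sub>r\<close> are then distinct.
\<close>

hide_const (open) Coset.order module.smult
no_notation fps_nth (infixl \<open>$\<close> 75)

section \<open>Places of a field\<close>

text \<open>A homomorphism defined on a subring is represented by its graph, so that extension of
  homomorphisms becomes inclusion.\<close>

definition subring_rel :: "('f::comm_ring_1 \<times> 'a::comm_ring_1) set \<Rightarrow> bool" where
  "subring_rel G \<longleftrightarrow> (1, 1) \<in> G \<and>
     (\<forall>x y u v. (x, y) \<in> G \<longrightarrow> (u, v) \<in> G \<longrightarrow> (x - u, y - v) \<in> G \<and> (x * u, y * v) \<in> G)"

text \<open>Closure under differences reduces single-valuedness of the relation to its value at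
  \<open>0\<close>.\<close>

definition partial_hom :: "('f::comm_ring_1 \<times> 'a::comm_ring_1) set \<Rightarrow> bool" where
  "partial_hom G \<longleftrightarrow> subring_rel G \<and> (\<forall>y. (0, y) \<in> G \<longrightarrow> y = 0)"

lemma subring_rel_one: "subring_rel G \<Longrightarrow> (1, 1) \<in> G"
  and subring_rel_diff: "subring_rel G \<Longrightarrow> (x, y) \<in> G \<Longrightarrow> (u, v) \<in> G \<Longrightarrow> (x - u, y - v) \<in> G"
  and subring_rel_mult: "subring_rel G \<Longrightarrow> (x, y) \<in> G \<Longrightarrow> (u, v) \<in> G \<Longrightarrow> (x * u, y * v) \<in> G"
  unfolding subring_rel_def by blast+

lemma subring_rel_zero: "subring_rel G \<Longrightarrow> (0, 0) \<in> G"
  using subring_rel_diff[OF _ subring_rel_one subring_rel_one] by fastforce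

lemma subring_rel_uminus: "subring_rel G \<Longrightarrow> (x, y) \<in> G \<Longrightarrow> (- x, - y) \<in> G"
  using subring_rel_diff[OF _ subring_rel_zero, of G x y] by simp

lemma subring_rel_add: "subring_rel G \<Longrightarrow> (x, y) \<in> G \<Longrightarrow> (u, v) \<in> G \<Longrightarrow> (x + u, y + v) \<in> G"
  using subring_rel_diff[OF _ _ subring_rel_uminus, of G x y u v] by simp

lemma subring_rel_power: "subring_rel G \<Longrightarrow> (x, y) \<in> G \<Longrightarrow> (x ^ n, y ^ n) \<in> G"
  by (induction n) (auto intro: subring_rel_one subring_rel_mult)

lemma subring_rel_sum:
  "subring_rel G \<Longrightarrow> (\<And>i. i \<in> A \<Longrightarrow> (f i, g i) \<in> G) \<Longrightarrow> (sum f A, sum g A) \<in> G"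
  by (induction A rule: infinite_finite_induct) (auto intro: subring_rel_zero subring_rel_add)

lemma subring_rel_prod:
  "subring_rel G \<Longrightarrow> (\<And>i. i \<in> A \<Longrightarrow> (f i, g i) \<in> G) \<Longrightarrow> (prod f A, prod g A) \<in> G"
  by (induction A rule: infinite_finite_induct) (auto intro: subring_rel_one subring_rel_mult)

lemma partial_hom_subring: "partial_hom G \<Longrightarrow> subring_rel G"
  by (simp add: partial_hom_def)

lemma partial_hom_unique: "partial_hom G \<Longrightarrow> (x, y) \<in> G \<Longrightarrow> (x, z) \<in> G \<Longrightarrow> y = z"
  using subring_rel_diff[of G x y x z] by (auto simp: partial_hom_def)

section \<open>Polynomials over a subring, and polynomial ideals\<close>

text \<open>For a partial homomorphism this is the graph of the map it induces on polynomials,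
  coefficient by coefficient.\<close>

definition poly_rel :: "('f::comm_ring_1 \<times> 'a::comm_ring_1) set \<Rightarrow> ('f poly \<times> 'a poly) set" where
  "poly_rel G = {(p, q). \<forall>i. (coeff p i, coeff q i) \<in> G}"

lemma subring_poly_rel:
  assumes G: "subring_rel G" shows "subring_rel (poly_rel G)"
  unfolding subring_rel_def
proof (intro conjI allI impI)
  show "(1, 1) \<in> poly_rel G"
    unfolding poly_rel_def using subring_rel_zero[OF G] subring_rel_one[OF G] by (auto simp: coeff_1)
next
  fix p q r s assume "(p, q) \<in> poly_rel G" "(r, s) \<in> poly_rel G"
  then have pq: "(coeff p i, coeff q i) \<in> G" "(coeff r i, coeff s i) \<in> G" for i
    unfolding poly_rel_def by auto
  show "(p - r, q - s) \<in> poly_rel G"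
    unfolding poly_rel_def using subring_rel_diff[OF G pq] by auto
  show "(p * r, q * s) \<in> poly_rel G"
    unfolding poly_rel_def coeff_mult
    unfolding mem_Collect_eq case_prod_conv coeff_mult
    by (intro allI subring_rel_sum[OF G] subring_rel_mult[OF G] pq)
qed

lemma poly_rel_pCons: "(a, b) \<in> G \<Longrightarrow> (p, q) \<in> poly_rel G \<Longrightarrow> (pCons a p, pCons b q) \<in> poly_rel G"
  unfolding poly_rel_def by (auto simp: coeff_pCons split: nat.splits)

lemma poly_rel_0: "subring_rel G \<Longrightarrow> (0, 0) \<in> poly_rel G"
  by (simp add: subring_rel_zero subring_poly_rel)

lemma poly_rel_const: "subring_rel G \<Longrightarrow> (a, b) \<in> G \<Longrightarrow> ([:a:], [:b:]) \<in> poly_rel G"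
  by (intro poly_rel_pCons poly_rel_0)

text \<open>A nonzero element of least degree generates, since remainders modulo it stay in the
  ideal. Ideals are given as plain sets closed under differences and multiples.\<close>

lemma poly_ideal_generator:
  fixes J :: "'a::field poly set"
  assumes nz: "p \<in> J" "p \<noteq> 0"
    and diff: "\<And>q r. q \<in> J \<Longrightarrow> r \<in> J \<Longrightarrow> q - r \<in> J"
    and mult: "\<And>q r. q \<in> J \<Longrightarrow> r * q \<in> J"
  obtains g where "g \<in> J" "g \<noteq> 0" "\<And>q. q \<in> J \<Longrightarrow> g dvd q"
proof -
  obtain g where g: "g \<in> J" "g \<noteq> 0" and least: "\<And>r. r \<in> J \<Longrightarrow> r \<noteq> 0 \<Longrightarrow> degree g \<le> degree r"
    using ex_has_least_nat[of "\<lambda>q. q \<in> J \<and> q \<noteq> 0" p degree] nz by blast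
  have "g dvd r" if r: "r \<in> J" for r
  proof -
    have "r mod g = r - (r div g) * g" by (simp add: minus_div_mult_eq_mod)
    then have "r mod g \<in> J" using diff mult r g by simp
    then have "r mod g = 0" using least[of "r mod g"] degree_mod_less[OF g(2), of r] by force
    then show ?thesis by (simp add: mod_eq_0_iff_dvd)
  qed
  then show ?thesis using that g by blast
qed

section \<open>Maximal partial homomorphisms and their valuation rings\<close>

text \<open>The values lie in an algebraically closed field, and \<open>\<iota>\<close> chooses a
  preimage of each of them. Maximality among graphs is what makes the domain a valuation
  ring.\<close>

locale place =
  fixes G :: "('f::field \<times> 'a::alg_closed_field) set" and \<iota> :: "'a \<Rightarrow> 'f"
  assumes hom: "partial_hom G"
    and scalars: "(\<iota> c, c) \<in> G"
    and maximal: "\<And>G'. partial_hom G' \<Longrightarrow> G \<subseteq> G' \<Longrightarrow> G' = G"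
begin

lemmas sub = partial_hom_subring[OF hom]

text \<open>The homomorphism extends to the fractions with denominator a power of \<open>x\<close>,
  so by maximality these fractions were already in the domain.\<close>

lemma inverse_mem:
  assumes "(x, y) \<in> G" "y \<noteq> 0"
  shows "(inverse x, inverse y) \<in> G"
proof -
  have x: "x \<noteq> 0" using assms hom unfolding partial_hom_def by auto
  define G' where "G' = {(p / x ^ n, q / y ^ n) | p q n. (p, q) \<in> G}"
  have pw: "(x ^ n, y ^ n) \<in> G" for n using assms sub by (intro subring_rel_power)
  have "partial_hom G'"
    unfolding partial_hom_def subring_rel_def
  proof (intro conjI allI impI)
    show "(1, 1) \<in> G'" unfolding G'_def using subring_rel_one[OF sub]
      by (intro CollectI exI[of _ 1] exI[of _ 0]) auto
  next
    fix p q r s assume "(p, q) \<in> G'" "(r, s) \<in> G'"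
    then obtain a b n c d m where 1: "p = a / x ^ n" "q = b / y ^ n" "(a, b) \<in> G"
      "r = c / x ^ m" "s = d / y ^ m" "(c, d) \<in> G" unfolding G'_def by blast
    have "(a * x ^ m - c * x ^ n, b * y ^ m - d * y ^ n) \<in> G"
      using subring_rel_diff[OF sub subring_rel_mult[OF sub 1(3) pw] subring_rel_mult[OF sub 1(6) pw]] .
    moreover have "p - r = (a * x ^ m - c * x ^ n) / x ^ (n + m)"
      "q - s = (b * y ^ m - d * y ^ n) / y ^ (n + m)"
      unfolding 1 using x assms(2) by (simp_all add: divide_simps power_add)
    ultimately show "(p - r, q - s) \<in> G'" unfolding G'_def by blast
    have "(a * c, b * d) \<in> G" by (rule subring_rel_mult[OF sub 1(3) 1(6)])
    moreover have "p * r = (a * c) / x ^ (n + m)" "q * s = (b * d) / y ^ (n + m)"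
      unfolding 1 by (simp_all add: power_add)
    ultimately show "(p * r, q * s) \<in> G'" unfolding G'_def by blast
  next
    fix q assume "(0, q) \<in> G'"
    then show "q = 0" unfolding G'_def using x hom by (auto simp: partial_hom_def)
  qed
  moreover have "G \<subseteq> G'"
  proof (rule subrelI)
    fix p q assume "(p, q) \<in> G"
    then have "(p / x ^ 0, q / y ^ 0) \<in> G'" unfolding G'_def by blast
    then show "(p, q) \<in> G'" by simp
  qed
  ultimately have "G' = G" by (rule maximal)
  moreover have "(1 / x ^ 1, 1 / y ^ 1) \<in> G'" unfolding G'_def using subring_rel_one[OF sub] by blast
  ultimately show ?thesis by (simp add: inverse_eq_divide)
qed

text \<open>The hypothesis says exactly that sending \<open>x\<close> to \<open>t\<close> is well
  defined on polynomial expressions in \<open>x\<close>; maximality then puts \<open>x\<close> into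
  the domain.\<close>

lemma adjoin:
  assumes root: "\<And>p q. (p, q) \<in> poly_rel G \<Longrightarrow> poly p x = 0 \<Longrightarrow> poly q t = 0"
  shows "(x, t) \<in> G"
proof -
  define G' where "G' = {(poly p x, poly q t) | p q. (p, q) \<in> poly_rel G}"
  have P: "subring_rel (poly_rel G)" using sub by (rule subring_poly_rel)
  have "partial_hom G'"
    unfolding partial_hom_def subring_rel_def
  proof (intro conjI allI impI)
    show "(1, 1) \<in> G'" unfolding G'_def using subring_rel_one[OF P] by (force intro!: exI[of _ 1])
  next
    fix p q r s assume "(p, q) \<in> G'" "(r, s) \<in> G'"
    then obtain a b c d where 1: "p = poly a x" "q = poly b t" "(a, b) \<in> poly_rel G"
      "r = poly c x" "s = poly d t" "(c, d) \<in> poly_rel G" unfolding G'_def by blast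
    have "(a - c, b - d) \<in> poly_rel G" "(a * c, b * d) \<in> poly_rel G"
      using subring_rel_diff[OF P 1(3) 1(6)] subring_rel_mult[OF P 1(3) 1(6)] .
    then show "(p - r, q - s) \<in> G'" "(p * r, q * s) \<in> G'"
      unfolding G'_def 1 poly_diff[symmetric] poly_mult[symmetric] by blast+
  next
    fix q assume "(0, q) \<in> G'"
    then show "q = 0" unfolding G'_def using root by auto
  qed
  moreover have "G \<subseteq> G'"
  proof (rule subrelI)
    fix a b assume "(a, b) \<in> G"
    then have "(poly [:a:] x, poly [:b:] t) \<in> G'"
      unfolding G'_def using poly_rel_const[OF sub] by blast
    then show "(a, b) \<in> G'" by simp
  qed
  ultimately have "G' = G" by (rule maximal)
  moreover have "(poly [:0, 1:] x, poly [:0, 1:] t) \<in> G'" unfolding G'_def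
    using poly_rel_pCons[OF subring_rel_zero[OF sub] poly_rel_const[OF sub subring_rel_one[OF sub]]]
    by blast
  ultimately show ?thesis by simp
qed

text \<open>The residues of the polynomials that vanish at \<open>x\<close> form an ideal
  \<open>J\<close>. A common root of \<open>J\<close> would be a possible value for
  \<open>x\<close>, so \<open>J\<close> contains \<open>1\<close>. The resulting relation has
  constant coefficient with residue \<open>1\<close> and all other coefficients with residue
  \<open>0\<close>.\<close>

lemma not_mem_relation:
  assumes x: "\<And>t. (x, t) \<notin> G"
  obtains p where "(p, 1) \<in> poly_rel G" "poly p x = 0"
proof -
  define J where "J = {q. \<exists>p. (p, q) \<in> poly_rel G \<and> poly p x = 0}"
  have P: "subring_rel (poly_rel G)" using sub by (rule subring_poly_rel)
  have lift: "\<exists>p. (p, q) \<in> poly_rel G" for q :: "'a poly"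
  proof (induction q)
    case 0 then show ?case using poly_rel_0[OF sub] by blast
  next
    case (pCons a q) then show ?case using poly_rel_pCons[OF scalars] by blast
  qed
  have Jdiff: "q - q' \<in> J" if qJ: "q \<in> J" "q' \<in> J" for q q'
  proof -
    obtain p p' where 1: "(p, q) \<in> poly_rel G" "poly p x = 0" "(p', q') \<in> poly_rel G" "poly p' x = 0"
      using qJ unfolding J_def by blast
    then have "(p - p', q - q') \<in> poly_rel G" "poly (p - p') x = 0"
      using subring_rel_diff[OF P 1(1) 1(3)] by simp_all
    then show ?thesis unfolding J_def by blast
  qed
  have Jmult: "r * q \<in> J" if q: "q \<in> J" for q r
  proof -
    obtain p where 1: "(p, q) \<in> poly_rel G" "poly p x = 0" using q unfolding J_def by blast
    obtain p' where 2: "(p', r) \<in> poly_rel G" using lift by blast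
    have "(p' * p, r * q) \<in> poly_rel G" "poly (p' * p) x = 0"
      using subring_rel_mult[OF P 2 1(1)] 1 by simp_all
    then show ?thesis unfolding J_def by blast
  qed
  \<comment> \<open>For \<open>J = {0}\<close> any value at \<open>x\<close> would satisfy the
    condition of \<open>adjoin\<close>; \<open>0\<close> is one choice.\<close>
  have "\<exists>q\<in>J. q \<noteq> 0"
  proof (rule ccontr)
    assume none: "\<not> ?thesis"
    have "(x, 0) \<in> G"
    proof (rule adjoin)
      fix p q assume "(p, q) \<in> poly_rel G" "poly p x = 0"
      then have "q \<in> J" unfolding J_def by blast
      then show "poly q 0 = 0" using none by auto
    qed
    with x show False by blast
  qed
  then obtain p where "p \<in> J" "p \<noteq> 0" by blast
  then obtain q where q: "q \<in> J" "q \<noteq> 0" and dvd: "\<And>r. r \<in> J \<Longrightarrow> q dvd r"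
    using Jdiff Jmult by (rule poly_ideal_generator) blast+
  \<comment> \<open>Algebraic closedness enters here: a nonconstant generator has a root, which is a
    root of all of \<open>J\<close>.\<close>
  have "degree q = 0"
  proof (rule ccontr)
    assume "degree q \<noteq> 0"
    then obtain t where t: "poly q t = 0" using alg_closed_imp_poly_has_root[of q] by auto
    have "(x, t) \<in> G"
    proof (rule adjoin)
      fix p r assume "(p, r) \<in> poly_rel G" "poly p x = 0"
      then have "q dvd r" by (intro dvd) (unfold J_def, blast)
      then show "poly r t = 0" using t by (auto elim: dvdE)
    qed
    with x show False by blast
  qed
  then obtain c where c: "q = [:c:]" "c \<noteq> 0" using q(2) by (metis degree_eq_zeroE pCons_0_0)
  have "[:inverse c:] * q = 1" unfolding c(1) using c(2) by (simp add: one_pCons)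
  then have "1 \<in> J" using Jmult[OF q(1), of "[:inverse c:]"] by simp
  then obtain p where "(p, 1) \<in> poly_rel G" "poly p x = 0" unfolding J_def by blast
  then show ?thesis by (rule that)
qed

text \<open>The defining property of a valuation ring. If neither \<open>x\<close> nor its inverse
  had a value, both would satisfy relations as in \<open>not_mem_relation\<close>, and these could
  be shortened forever.\<close>

lemma mem_or_inverse:
  assumes x0: "x \<noteq> 0" and x: "\<And>t. (x, t) \<notin> G"
  shows "(inverse x, 0) \<in> G"
proof -
  define R where "R y p \<longleftrightarrow> (p, 1) \<in> poly_rel G \<and> poly p y = 0" for y p
  text \<open>Two relations, for \<open>x\<close> and for its inverse, with all coefficients but the first in the
    maximal ideal: the one of smaller degree can be used to shorten the other one.\<close>
  have shorten: "\<exists>p'. R y p' \<and> degree p' < degree p"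
    if R: "R y p" "R (inverse y) q" and y0: "y \<noteq> 0" and le: "degree q \<le> degree p" for y p q
  proof -
    have pc: "(coeff p i, if i = 0 then 1 else 0) \<in> G" for i
      using R(1) unfolding R_def poly_rel_def by (cases "i = 0") (auto simp: coeff_1 dest: spec[of _ i])
    have qc: "(coeff q i, if i = 0 then 1 else 0) \<in> G" for i
      using R(2) unfolding R_def poly_rel_def by (cases "i = 0") (auto simp: coeff_1 dest: spec[of _ i])
    define e where "e = degree p"
    define d where "d = degree q"
    define c where "c = inverse (coeff q 0)"
    have q0: "coeff q 0 \<noteq> 0" using qc[of 0] hom unfolding partial_hom_def by force
    have c: "(c, 1) \<in> G" using inverse_mem[of "coeff q 0" 1] qc[of 0] by (simp add: c_def)
    have e0: "e > 0"
    proof (rule ccontr)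
      assume "\<not> e > 0"
      then have "poly p y = coeff p 0" unfolding e_def by (simp add: poly_altdef)
      then have "coeff p 0 = 0" using R(1) by (simp add: R_def)
      then show False using pc[of 0] hom unfolding partial_hom_def by auto
    qed
    \<comment> \<open>the reciprocal polynomial of \<open>q\<close> vanishes at \<open>y\<close> and has leading coefficient \<open>coeff q 0\<close>\<close>
    define r where "r = p - monom (coeff p e * c) (e - d) * (\<Sum>i\<le>d. monom (coeff q i) (d - i))"
    have rc: "coeff r j = coeff p j - (if e - d \<le> j \<and> j \<le> e then coeff p e * c * coeff q (e - j) else 0)" for j
    proof -
      have "coeff (monom (coeff p e * c) (e - d) * (\<Sum>i\<le>d. monom (coeff q i) (d - i))) j
        = (\<Sum>i\<le>d. if e - d + (d - i) = j then coeff p e * c * coeff q i else 0)"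
        by (simp add: sum_distrib_left mult_monom coeff_sum)
      also have "\<dots> = (\<Sum>i\<le>d. if i = e - j \<and> e - d \<le> j \<and> j \<le> e then coeff p e * c * coeff q i else 0)"
        using le by (intro sum.cong refl) (auto simp: d_def e_def)
      also have "\<dots> = (if e - d \<le> j \<and> j \<le> e then coeff p e * c * coeff q (e - j) else 0)"
        using le by (auto simp: d_def e_def)
      finally show ?thesis by (simp add: r_def)
    qed
    have "coeff r j = 0" if "j \<ge> e" for j
      using that q0 le unfolding rc by (cases "j = e") (auto simp: c_def e_def d_def coeff_eq_0)
    then have deg: "degree r < e" using e0 by (metis degree_0 leading_coeff_0_iff not_le_imp_less)
    have "poly (\<Sum>i\<le>d. monom (coeff q i) (d - i)) y = (\<Sum>i\<le>d. coeff q i * inverse y ^ i) * y ^ d"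
      unfolding poly_sum poly_monom sum_distrib_right
      using y0 by (intro sum.cong refl) (auto simp: field_simps power_diff)
    also have "\<dots> = 0" using R(2) unfolding R_def poly_altdef[of q] d_def by simp
    finally have "poly r y = 0" using R(1) by (simp add: r_def R_def)
    moreover have "(r, 1) \<in> poly_rel G"
      unfolding poly_rel_def
    proof (clarify)
      fix j
      have pe: "(coeff p e, 0) \<in> G" using pc[of e] e0 by simp
      have "(coeff p e * c * coeff q (e - j), 0 * 1 * (if e - j = 0 then 1 else 0)) \<in> G"
        by (rule subring_rel_mult[OF sub subring_rel_mult[OF sub pe c] qc])
      then have "(coeff p j - coeff p e * c * coeff q (e - j), (if j = 0 then 1 else 0) - 0) \<in> G"
        using subring_rel_diff[OF sub pc, of _ _ j] by fastforce
      then show "(coeff r j, coeff (1 :: 'a poly) j) \<in> G"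
        unfolding rc using pc[of j] by (cases j) (auto simp: coeff_1)
    qed
    ultimately show ?thesis using deg unfolding R_def e_def by auto
  qed
  \<comment> \<open>Induction on the sum of the two degrees; exchanging \<open>y\<close> with its
    inverse lets the longer relation always be the one that is shortened.\<close>
  have no: "\<not> (R y p \<and> R (inverse y) q)" if "y \<noteq> 0" for y p q
    using that
  proof (induction "degree p + degree q" arbitrary: y p q rule: less_induct)
    case less
    show ?case
    proof
      assume R: "R y p \<and> R (inverse y) q"
      show False
      proof (cases "degree q \<le> degree p")
        case True
        then obtain p' where "R y p'" "degree p' < degree p" using shorten R less.prems by blast
        then show False using less.hyps[of p' q y] R less.prems by auto
      next
        case False
        then obtain p' where "R (inverse y) p'" "degree p' < degree q"
          using shorten[of "inverse y" q p] R less.prems by auto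
        then show False using less.hyps[of p p' y] R less.prems by auto
      qed
    qed
  qed
  obtain p where p: "R x p" using not_mem_relation[OF x] unfolding R_def by blast
  have "\<exists>t. (inverse x, t) \<in> G"
  proof (rule ccontr)
    assume "\<not> ?thesis"
    then obtain q where "R (inverse x) q" using not_mem_relation[of "inverse x"] unfolding R_def by blast
    with p no x0 show False by blast
  qed
  then obtain t where t: "(inverse x, t) \<in> G" by blast
  \<comment> \<open>A nonzero value of the inverse could be inverted, giving \<open>x\<close> a
    value.\<close>
  moreover have "t = 0"
  proof (rule ccontr)
    assume "t \<noteq> 0"
    then show False using inverse_mem[OF t] x by auto
  qed
  ultimately show ?thesis by simp
qed

text \<open>Divisibility with respect to a valuation ring is a total preorder on nonzero elements,
  so a finite set has an element whose quotients into all others are finite at the place.\<close>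

lemma dominating_element:
  assumes "finite A" "x \<in> A" "x \<noteq> 0"
  obtains y where "y \<in> A" "y \<noteq> 0" "\<And>z. z \<in> A \<Longrightarrow> \<exists>t. (z / y, t) \<in> G"
proof -
  define dom where "dom y z \<longleftrightarrow> (\<exists>t. (z / y, t) \<in> G)" for y z
  have tot: "dom y z \<or> dom z y" if "y \<noteq> 0" "z \<noteq> 0" for y z
  proof (cases "\<exists>t. (z / y, t) \<in> G")
    case False
    then have "(inverse (z / y), 0) \<in> G" using that by (intro mem_or_inverse) auto
    then show ?thesis unfolding dom_def by auto
  qed (simp add: dom_def)
  have trans: "dom y w" if yzw: "dom y z" "dom z w" "z \<noteq> 0" for y z w
  proof -
    obtain s t where 1: "(z / y, s) \<in> G" "(w / z, t) \<in> G" using yzw unfolding dom_def by blast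
    have "(z / y * (w / z), s * t) \<in> G" by (rule subring_rel_mult[OF sub 1])
    then show ?thesis unfolding dom_def using yzw(3) by auto
  qed
  have refl: "dom y y" if "y \<noteq> 0" for y
    unfolding dom_def using subring_rel_one[OF sub] that by auto
  have zero: "dom y 0" for y unfolding dom_def using subring_rel_zero[OF sub] by auto
  have "\<exists>y\<in>A. y \<noteq> 0 \<and> (\<forall>z\<in>A. dom y z)" if "finite A" "\<exists>x\<in>A. x \<noteq> 0" for A
    using that
  proof (induction A)
    case (insert a A)
    show ?case
    proof (cases "\<exists>x\<in>A. x \<noteq> 0")
      case True
      then obtain y where y: "y \<in> A" "y \<noteq> 0" "\<forall>z\<in>A. dom y z" using insert by auto
      show ?thesis
      proof (cases "dom y a")
        case True with y show ?thesis by auto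
      next
        case False
        then have "a \<noteq> 0" using zero by auto
        moreover have "dom a y" using tot False \<open>a \<noteq> 0\<close> y by blast
        ultimately show ?thesis using y trans refl by (metis insert_iff)
      qed
    next
      case False
      then show ?thesis using insert.prems refl zero by (metis insert_iff)
    qed
  qed simp
  from this[OF assms(1)] assms show ?thesis using that unfolding dom_def by blast
qed

end

text \<open>Zorn's lemma: the union of a nonempty chain of graphs of partial homomorphisms is again
  such a graph.\<close>

lemma place_extension:
  fixes G :: "('f::field \<times> 'a::alg_closed_field) set"
  assumes hom: "partial_hom G" and scalars: "\<And>c. (\<iota> c, c) \<in> G"
  obtains H where "G \<subseteq> H" "place H \<iota>"
proof -
  define \<A> where "\<A> = {H. partial_hom H \<and> G \<subseteq> H}"
  have "\<exists>U\<in>\<A>. \<forall>X\<in>C. X \<subseteq> U" if C: "subset.chain \<A> C" for C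
  proof (cases "C = {}")
    case True then show ?thesis using hom unfolding \<A>_def by auto
  next
    case False
    have CA: "\<And>X. X \<in> C \<Longrightarrow> partial_hom X \<and> G \<subseteq> X" using C unfolding subset.chain_def \<A>_def by auto
    have join: "\<exists>X\<in>C. p \<in> X \<and> q \<in> X" if "p \<in> \<Union>C" "q \<in> \<Union>C" for p q
      using that C unfolding subset.chain_def by blast
    have "partial_hom (\<Union>C)"
      unfolding partial_hom_def subring_rel_def
    proof (intro conjI allI impI)
      show "(1, 1) \<in> \<Union>C" using False CA subring_rel_one partial_hom_subring by blast
    next
      fix x y u v assume "(x, y) \<in> \<Union>C" "(u, v) \<in> \<Union>C"
      then obtain X where "X \<in> C" "(x, y) \<in> X" "(u, v) \<in> X" using join by blast
      then show "(x - u, y - v) \<in> \<Union>C" "(x * u, y * v) \<in> \<Union>C"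
        using CA subring_rel_diff subring_rel_mult partial_hom_subring by blast+
    next
      fix y assume "(0, y) \<in> \<Union>C"
      then show "y = 0" using CA unfolding partial_hom_def by blast
    qed
    moreover have "G \<subseteq> \<Union>C" using False CA by blast
    ultimately show ?thesis unfolding \<A>_def by blast
  qed
  from subset_Zorn[OF this] obtain H where H: "H \<in> \<A>" "\<forall>X\<in>\<A>. H \<subseteq> X \<longrightarrow> X = H" by blast
  show ?thesis
  proof (rule that)
    show "G \<subseteq> H" using H unfolding \<A>_def by blast
    show "place H \<iota>"
    proof
      show "partial_hom H" using H unfolding \<A>_def by blast
      show "(\<iota> c, c) \<in> H" for c using H scalars unfolding \<A>_def by blast
      show "H' = H" if "partial_hom H'" "H \<subseteq> H'" for H'
        using H that unfolding \<A>_def by blast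
    qed
  qed
qed

section \<open>A formal deformation of the weights\<close>

text \<open>For \<open>P = \<Prod> (x - s r) ^ a r\<close> this is the derivative of \<open>P\<close> divided by
  \<open>\<Prod> (x - s r) ^ (a r - 1)\<close>.\<close>

definition wderiv :: "(nat \<Rightarrow> 'a::comm_ring_1) \<Rightarrow> (nat \<Rightarrow> 'a) \<Rightarrow> nat \<Rightarrow> 'a poly" where
  "wderiv a s N = (\<Sum>r<N. smult (a r) (\<Prod>q\<in>{..<N} - {r}. [:- s q, 1:]))"

lemma monic_prod_linear:
  fixes s :: "'b \<Rightarrow> 'a::idom"
  assumes "finite A"
  shows "degree (\<Prod>q\<in>A. [:- s q, 1:]) = card A" "coeff (\<Prod>q\<in>A. [:- s q, 1:]) (card A) = 1"
proof -
  show deg: "degree (\<Prod>q\<in>A. [:- s q, 1:]) = card A"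
    by (subst degree_prod_eq_sum_degree) auto
  show "coeff (\<Prod>q\<in>A. [:- s q, 1:]) (card A) = 1"
    using lead_coeff_prod[of "\<lambda>q. [:- s q, 1:]" A] unfolding deg by simp
qed

lemma degree_wderiv_le:
  fixes s :: "nat \<Rightarrow> 'a::idom"
  shows "degree (wderiv a s N) \<le> N - 1"
  unfolding wderiv_def
proof (rule degree_sum_le)
  fix r assume "r \<in> {..<N}"
  then show "degree (smult (a r) (\<Prod>q\<in>{..<N} - {r}. [:- s q, 1:])) \<le> N - 1"
    using degree_smult_le[of "a r"] monic_prod_linear(1)[of "{..<N} - {r}" s] by (metis card_Diff_singleton card_lessThan finite_Diff finite_lessThan)
qed simp

lemma coeff_wderiv:
  fixes s :: "nat \<Rightarrow> 'a::idom"
  shows "coeff (wderiv a s N) (N - 1) = (\<Sum>r<N. a r)"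
  unfolding wderiv_def coeff_sum
proof (intro sum.cong refl)
  fix r assume "r \<in> {..<N}"
  then have "card ({..<N} - {r}) = N - 1" by simp
  then show "coeff (smult (a r) (\<Prod>q\<in>{..<N} - {r}. [:- s q, 1:])) (N - 1) = a r"
    using monic_prod_linear(2)[of "{..<N} - {r}" s] by simp
qed

text \<open>With unit weights the zeros enter only through an ordinary derivative, which can be
  integrated explicitly.\<close>

lemma wderiv_one: "wderiv (\<lambda>_. 1) s N = pderiv (\<Prod>q<N. [:- s q, 1:])"
  unfolding wderiv_def pderiv_prod by (intro sum.cong refl) (simp add: pderiv_pCons)

lemma dvd_prod_diff:
  fixes f g :: "'b \<Rightarrow> 'a::comm_ring_1"
  assumes "\<And>i. i \<in> A \<Longrightarrow> c dvd f i - g i"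
  shows "c dvd prod f A - prod g A"
  using assms
proof (induction A rule: infinite_finite_induct)
  case (insert a A)
  have "prod f (insert a A) - prod g (insert a A)
      = (f a - g a) * prod f A + g a * (prod f A - prod g A)"
    using insert.hyps by (simp add: algebra_simps)
  then show ?case using insert by (simp add: dvd_add)
qed simp_all

section \<open>Power series coefficients and formal integration\<close>

lemma fps_X_power_dvd_iff:
  fixes f :: "'a::field fps"
  shows "fps_X ^ n dvd f \<longleftrightarrow> (\<forall>i<n. fps_nth f i = 0)"
  by (cases "f = 0") (auto simp: fps_dvd_iff subdegree_geI intro: nth_less_subdegree_zero)

lemma fps_const_prod: "fps_const (prod f A) = (\<Prod>i\<in>A. fps_const (f i))"
  by (induction A rule: infinite_finite_induct) (simp_all flip: fps_const_mult)

lemma fps_const_sum: "fps_const (sum f A) = (\<Sum>i\<in>A. fps_const (f i))"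
  by (induction A rule: infinite_finite_induct) (simp_all flip: fps_const_add)

lemma map_poly_fps_const_mult:
  "map_poly fps_const (p * q) = map_poly fps_const p * map_poly fps_const q"
  by (intro poly_eqI) (simp add: coeff_map_poly coeff_mult fps_const_sum)

lemma map_poly_fps_const_prod:
  "map_poly fps_const (prod f A) = (\<Prod>i\<in>A. map_poly fps_const (f i))"
  by (induction A rule: infinite_finite_induct) (simp_all add: map_poly_fps_const_mult)

lemma map_poly_fps_const_pderiv: "map_poly fps_const (pderiv p) = pderiv (map_poly fps_const p)"
  by (intro poly_eqI) (simp add: coeff_map_poly coeff_pderiv fps_of_nat[symmetric] del: of_nat_Suc)

text \<open>The integral of \<open>W\<close> from \<open>0\<close> to \<open>t\<close>, for \<open>W\<close> of degree less than \<open>N\<close>.\<close>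

definition antideriv :: "nat \<Rightarrow> 'a::field_char_0 \<Rightarrow> 'a fps poly \<Rightarrow> 'a fps" where
  "antideriv N t W = (\<Sum>i<N. coeff W i * fps_const (t ^ Suc i / of_nat (Suc i)))"

lemma antideriv_diff: "antideriv N t (V - W) = antideriv N t V - antideriv N t W"
  unfolding antideriv_def by (simp add: sum_subtractf algebra_simps)

lemma antideriv_add: "antideriv N t (V + W) = antideriv N t V + antideriv N t W"
  unfolding antideriv_def by (simp add: sum.distrib algebra_simps)

lemma antideriv_dvd: "[:c:] dvd W \<Longrightarrow> c dvd antideriv N t W"
  unfolding antideriv_def const_poly_dvd_iff by (intro dvd_sum dvd_mult2) auto

lemma antideriv_0: "antideriv N 0 W = 0"
  unfolding antideriv_def by simp

lemma antideriv_pderiv: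
  assumes "degree Q \<le> N"
  shows "antideriv N t (pderiv Q) = poly Q (fps_const t) - coeff Q 0"
proof -
  have "antideriv N t (pderiv Q) = (\<Sum>i<N. coeff Q (Suc i) * fps_const t ^ Suc i)"
    unfolding antideriv_def
  proof (intro sum.cong refl)
    fix i
    have "(of_nat (Suc i) :: 'a fps) * fps_const (t ^ Suc i / of_nat (Suc i)) = fps_const t ^ Suc i"
      unfolding fps_of_nat[symmetric] fps_const_mult fps_const_power by (simp del: of_nat_Suc)
    then show "coeff (pderiv Q) i * fps_const (t ^ Suc i / of_nat (Suc i))
        = coeff Q (Suc i) * fps_const t ^ Suc i"
      unfolding coeff_pderiv by (metis mult.assoc mult.commute)
  qed
  also have "\<dots> = (\<Sum>i\<le>N. coeff Q i * fps_const t ^ i) - coeff Q 0"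
    unfolding lessThan_Suc_atMost[symmetric] sum.lessThan_Suc_shift by simp
  also have "(\<Sum>i\<le>N. coeff Q i * fps_const t ^ i) = poly Q (fps_const t)"
    unfolding poly_altdef using assms
    by (intro sum.mono_neutral_right) (auto simp: coeff_eq_0)
  finally show ?thesis .
qed

text \<open>A fixed-point iteration that converges in the \<open>fps_X\<close>-adic topology. It
  starts from unit weights and zeros \<open>0, ..., N - 1\<close>, where the linearised problem is
  invertible because these zeros are distinct.\<close>

lemma formal_weight_deformation:
  fixes a :: "nat \<Rightarrow> 'a::field_char_0" and F :: "'a poly"
  assumes N: "N > 0" and deg: "degree F \<le> N - 1" and lead: "coeff F (N - 1) = (\<Sum>r<N. a r)"
  defines "Q0 \<equiv> (\<Prod>q<N. [:- of_nat q, 1:]) :: 'a poly"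
  obtains s :: "nat \<Rightarrow> 'a fps" where "s 0 = 0"
    "\<And>i. coeff (wderiv (\<lambda>r. 1 + fps_X * fps_const (a r - 1)) s N) i
        = fps_const (coeff (pderiv Q0) i) + fps_X * fps_const (coeff F i - coeff (pderiv Q0) i)"
proof -
  define \<kappa> :: "nat \<Rightarrow> 'a" where "\<kappa> r = (\<Prod>q\<in>{..<N} - {r}. of_nat r - of_nat q)" for r
  define A where "A r = 1 + fps_X * fps_const (a r - 1)" for r
  define c :: "nat \<Rightarrow> 'a fps" where "c r = fps_const (of_nat r)" for r
  define Fz where "Fz = map_poly fps_const (pderiv Q0) + [:fps_X:] * map_poly fps_const (F - pderiv Q0)"
  \<comment> \<open>A change \<open>d\<close> in \<open>s r\<close> changes the value of
    \<open>Q s\<close> at \<open>of_nat r\<close> by \<open>- d * \<kappa> r\<close> to first order,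
    and \<open>antideriv\<close> of the error measures how wrong that value is. So \<open>T\<close>
    is a Newton step with the derivative frozen at the starting point.\<close>
  define T where "T s r = s r + antideriv N (of_nat r) (wderiv A s N - Fz) * fps_const (inverse (\<kappa> r))"
    for s r
  have Fz: "coeff Fz i = fps_const (coeff (pderiv Q0) i) + fps_X * fps_const (coeff F i - coeff (pderiv Q0) i)" for i
    unfolding Fz_def by (simp add: coeff_map_poly)
  have \<kappa>: "\<kappa> r \<noteq> 0" if "r < N" for r
    unfolding \<kappa>_def by (auto simp: prod_zero_iff)
  \<comment> \<open>Fixing \<open>s 0 = 0\<close> removes the freedom of translation and makes
    \<open>Q s\<close> vanish at \<open>0\<close>, so that integration from \<open>0\<close>
    recovers its values.\<close>
  define near where "near s \<longleftrightarrow> s 0 = 0 \<and> (\<forall>r<N. fps_X dvd s r - c r)" for s :: "nat \<Rightarrow> 'a fps"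
  define pr where "pr s r = (\<Prod>q\<in>{..<N} - {r}. [:- s q, 1:])" for s :: "nat \<Rightarrow> 'a fps" and r
  define Q where "Q s = (\<Prod>q<N. [:- s q, 1:])" for s :: "nat \<Rightarrow> 'a fps"
  have Q_eval: "poly (Q s) (c r) = (c r - s r) * poly (pr s r) (c r)" if "r < N" for s r
    unfolding Q_def pr_def using that by (subst prod.remove[of _ r]) (auto simp: algebra_simps)
  have Q_zero: "coeff (Q s) 0 = 0" if "s 0 = 0" for s
    using that N unfolding poly_0_coeff_0[symmetric] Q_def poly_prod by auto
  have Q_deg: "degree (Q s) \<le> N" for s
    unfolding Q_def using monic_prod_linear(1)[of "{..<N}" s] by simp
  have pr_eval: "fps_X dvd poly (pr s r) (c r) - fps_const (\<kappa> r)" if "near s" "r < N" for s r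
  proof -
    have "fps_const (\<kappa> r) = (\<Prod>q\<in>{..<N} - {r}. c r - c q)"
      unfolding \<kappa>_def c_def fps_const_prod by simp
    moreover have "fps_X dvd (\<Prod>q\<in>{..<N} - {r}. c r - s q) - (\<Prod>q\<in>{..<N} - {r}. c r - c q)"
    proof (rule dvd_prod_diff)
      fix q assume "q \<in> {..<N} - {r}"
      then have "fps_X dvd s q - c q" using that unfolding near_def by auto
      then have "fps_X dvd - (s q - c q)" by (simp only: dvd_minus_iff)
      then show "fps_X dvd (c r - s q) - (c r - c q)" by simp
    qed
    ultimately show ?thesis unfolding pr_def poly_prod by simp
  qed
  have pr_close: "[:d:] dvd pr s r - pr s' r" if "\<forall>q<N. d dvd s q - s' q" for d s s' r
    unfolding pr_def
  proof (rule dvd_prod_diff)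
    fix q assume "q \<in> {..<N} - {r}"
    then have "d dvd - (s q - s' q)" using that by (simp only: dvd_minus_iff) auto
    then have "d dvd s' q - s q" by simp
    then show "[:d:] dvd [:- s q, 1:] - [:- s' q, 1:]"
      by (auto simp: const_poly_dvd_iff coeff_pCons split: nat.splits)
  qed
  \<comment> \<open>The part with unit weights is an exact derivative; all the rest carries a factor
    \<open>fps_X\<close>.\<close>
  have A1: "wderiv A s N = pderiv (Q s) + (\<Sum>r<N. [:fps_X:] * smult (fps_const (a r - 1)) (pr s r))" for s
    unfolding Q_def wderiv_one[symmetric] wderiv_def A_def pr_def
    by (simp add: smult_add_left sum.distrib mult.commute[of _ fps_X])
  have contract: "fps_X ^ Suc l dvd T s r - T s' r"
    if near: "near s" "near s'" and close: "\<forall>q<N. fps_X ^ l dvd s q - s' q" and r: "r < N" for s s' l r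
  proof -
    define R where "R = (\<Sum>q<N. [:fps_X:] * smult (fps_const (a q - 1)) (pr s q - pr s' q))"
    have "[:fps_X ^ Suc l:] dvd R"
      unfolding R_def
    proof (rule dvd_sum)
      fix q
      have "[:fps_X ^ l:] dvd smult (fps_const (a q - 1)) (pr s q - pr s' q)"
        using pr_close[OF close, of q] by (rule dvd_smult)
      then have "[:fps_X:] * [:fps_X ^ l:] dvd [:fps_X:] * smult (fps_const (a q - 1)) (pr s q - pr s' q)"
        by (rule mult_dvd_mono[OF dvd_refl])
      then show "[:fps_X ^ Suc l:] dvd [:fps_X:] * smult (fps_const (a q - 1)) (pr s q - pr s' q)"
        by (simp add: mult.commute)
    qed
    then have 1: "fps_X ^ Suc l dvd antideriv N (of_nat r) R" by (rule antideriv_dvd)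
    have W: "wderiv A s N - Fz - (wderiv A s' N - Fz) = (pderiv (Q s) - pderiv (Q s')) + R"
      unfolding A1 R_def by (simp add: sum_subtractf smult_diff_right algebra_simps)
    define p p' k where "p = poly (pr s r) (c r)" "p' = poly (pr s' r) (c r)" "k = fps_const (\<kappa> r)"
    have s0: "s 0 = 0" "s' 0 = 0" using near unfolding near_def by auto
    have "antideriv N (of_nat r) (wderiv A s N - Fz) - antideriv N (of_nat r) (wderiv A s' N - Fz)
        = poly (Q s) (c r) - poly (Q s') (c r) + antideriv N (of_nat r) R"
      unfolding antideriv_diff[symmetric] W antideriv_add
      unfolding antideriv_diff antideriv_pderiv[OF Q_deg] Q_zero[of s, OF s0(1)] Q_zero[of s', OF s0(2)]
      by (simp add: c_def)
    also have "poly (Q s) (c r) - poly (Q s') (c r) = (c r - s r) * (p - p') + (s' r - s r) * p'"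
      unfolding Q_eval[OF r] p_p'_k_def by (simp add: algebra_simps)
    finally have Tdiff: "antideriv N (of_nat r) (wderiv A s N - Fz) - antideriv N (of_nat r) (wderiv A s' N - Fz)
        = (c r - s r) * (p - p') + (s' r - s r) * p' + antideriv N (of_nat r) R" .
    have "T s r - T s' r = (s r - s' r) + (antideriv N (of_nat r) (wderiv A s N - Fz)
        - antideriv N (of_nat r) (wderiv A s' N - Fz)) * fps_const (inverse (\<kappa> r))"
      unfolding T_def by (simp add: algebra_simps)
    then have eq: "T s r - T s' r = (s r - s' r)
        + ((c r - s r) * (p - p') + (s' r - s r) * p' + antideriv N (of_nat r) R) * fps_const (inverse (\<kappa> r))"
      unfolding Tdiff .
    have k: "k * fps_const (inverse (\<kappa> r)) = 1" using \<kappa>[OF r] by (simp add: p_p'_k_def)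
    have "T s r - T s' r = (s r - s' r) * (k * fps_const (inverse (\<kappa> r)))
        + ((c r - s r) * (p - p') + (s' r - s r) * p' + antideriv N (of_nat r) R) * fps_const (inverse (\<kappa> r))"
      unfolding eq k by simp
    \<comment> \<open>The first-order term \<open>s r - s' r\<close> has cancelled. Each remaining
      term is divisible by one more power of \<open>fps_X\<close> than
      \<open>s - s'\<close>.\<close>
    also have "\<dots> = (antideriv N (of_nat r) R - (s r - c r) * (p - p') - (s r - s' r) * (p' - k)) * fps_const (inverse (\<kappa> r))"
      by (simp add: algebra_simps)
    finally have eq: "T s r - T s' r = \<dots>" .
    have "fps_X * fps_X ^ l dvd (s r - c r) * (p - p')"
    proof (rule mult_dvd_mono)
      show "fps_X dvd s r - c r" using near r unfolding near_def by auto
      obtain G where "pr s r - pr s' r = [:fps_X ^ l:] * G" using pr_close[OF close, of r] unfolding dvd_def by blast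
      then have "poly (pr s r - pr s' r) (c r) = poly ([:fps_X ^ l:] * G) (c r)" by simp
      then show "fps_X ^ l dvd p - p'" unfolding p_p'_k_def by simp
    qed
    then have 2: "fps_X ^ Suc l dvd (s r - c r) * (p - p')" by simp
    have "fps_X ^ l * fps_X dvd (s r - s' r) * (p' - k)"
      using close r pr_eval[OF near(2) r] unfolding p_p'_k_def by (intro mult_dvd_mono) auto
    then have 3: "fps_X ^ Suc l dvd (s r - s' r) * (p' - k)" by (simp add: mult.commute)
    show ?thesis unfolding eq by (intro dvd_mult2 dvd_diff 1 2 3)
  qed
  have T0: "T s 0 = s 0" for s by (simp add: T_def antideriv_0)
  have near_c: "near c" unfolding near_def c_def by simp
  have map_Q0: "map_poly fps_const (pderiv Q0) = pderiv (Q c)"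
  proof -
    have "map_poly fps_const Q0 = Q c"
      unfolding Q0_def Q_def c_def map_poly_fps_const_prod
      by (intro prod.cong refl poly_eqI) (auto simp: coeff_map_poly coeff_pCons split: nat.splits)
    then show ?thesis by (simp add: map_poly_fps_const_pderiv)
  qed
  have start: "fps_X dvd T c r - c r" for r
  proof -
    have eq: "wderiv A c N - Fz = [:fps_X:] * ((\<Sum>r<N. smult (fps_const (a r - 1)) (pr c r)) - map_poly fps_const (F - pderiv Q0))"
      unfolding A1 Fz_def map_Q0 by (simp add: sum_distrib_left algebra_simps)
    have "[:fps_X:] dvd wderiv A c N - Fz" unfolding eq by (rule dvd_triv_left)
    then have "fps_X dvd antideriv N (of_nat r) (wderiv A c N - Fz)" by (rule antideriv_dvd)
    then show ?thesis unfolding T_def by simp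
  qed
  define S where "S n = (T ^^ n) c" for n
  have S_Suc: "S (Suc n) = T (S n)" and S_0: "S 0 = c" for n by (simp_all add: S_def)
  have near_T: "near (T s)" if "near s" for s
    unfolding near_def
  proof (intro conjI allI impI)
    show "T s 0 = 0" using that T0 unfolding near_def by simp
    fix r assume r: "r < N"
    have "fps_X ^ Suc 0 dvd T s r - T c r" by (rule contract[OF that near_c _ r]) simp
    then have "fps_X dvd (T s r - T c r) + (T c r - c r)" using start by (intro dvd_add) auto
    then show "fps_X dvd T s r - c r" by simp
  qed
  have S_near: "near (S n)" for n by (induction n) (simp_all add: S_Suc S_0 near_c near_T)
  have S_step: "\<forall>r<N. fps_X ^ Suc n dvd S (Suc n) r - S n r" for n
  proof (induction n)
    case 0 then show ?case using start by (simp add: S_Suc S_0)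
  next
    case (Suc n)
    show ?case
    proof (intro allI impI)
      fix r assume "r < N"
      then have "fps_X ^ Suc (Suc n) dvd T (S (Suc n)) r - T (S n) r"
        by (rule contract[OF S_near S_near Suc.IH])
      then show "fps_X ^ Suc (Suc n) dvd S (Suc (Suc n)) r - S (Suc n) r" by (simp only: S_Suc)
    qed
  qed
  \<comment> \<open>The coefficient with index \<open>i\<close> no longer changes after the iterate
    \<open>S i\<close>, so the diagonal is the limit.\<close>
  define s where "s r = (if r < N then Abs_fps (\<lambda>i. fps_nth (S i r) i) else 0)" for r
  have S_stable: "fps_nth (S n r) i = fps_nth (S i r) i" if "i \<le> n" "r < N" for n r i
    using that(1)
  proof (induction n rule: dec_induct)
    case (step n)
    have "fps_nth (S (Suc n) r - S n r) i = 0"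
      using S_step[of n] that(2) step.hyps unfolding fps_X_power_dvd_iff by auto
    then show ?case using step.IH by simp
  qed simp
  have s_close: "\<forall>r<N. fps_X ^ Suc n dvd s r - S n r" for n
    unfolding fps_X_power_dvd_iff
  proof (intro allI impI)
    fix r i assume "r < N" "i < Suc n"
    then show "fps_nth (s r - S n r) i = 0" using S_stable[of i n r] by (simp add: s_def)
  qed
  have near_s: "near s"
    unfolding near_def
  proof (intro conjI allI impI)
    have "S n 0 = 0" for n using S_near[of n] by (simp add: near_def)
    then show "s 0 = 0" using N by (simp add: s_def fps_eq_iff)
    show "fps_X dvd s r - c r" if "r < N" for r using s_close[of 0] that by (simp add: S_0)
  qed
  have fix_T: "T s r = s r" if r: "r < N" for r
  proof -
    have "fps_X ^ Suc n dvd T s r - s r" for n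
    proof -
      have "fps_X ^ Suc (Suc n) dvd T s r - T (S n) r" by (rule contract[OF near_s S_near s_close r])
      moreover have "fps_X ^ Suc (Suc n) dvd s r - S (Suc n) r" using s_close r by blast
      ultimately have "fps_X ^ Suc (Suc n) dvd (T s r - T (S n) r) - (s r - S (Suc n) r)" by (rule dvd_diff)
      then have "fps_X ^ Suc (Suc n) dvd T s r - s r" by (simp add: S_Suc)
      then show ?thesis using power_le_dvd by (metis le_SucI order_refl)
    qed
    then have "fps_nth (T s r - s r) n = 0" for n unfolding fps_X_power_dvd_iff by blast
    then have "T s r - s r = 0" by (intro fps_ext) simp
    then show ?thesis by simp
  qed
  define W where "W = wderiv A s N - Fz"
  have W0: "antideriv N (of_nat r) W = 0" if "r < N" for r
    using fix_T[OF that] \<kappa>[OF that] unfolding T_def W_def by simp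
  have degFz: "coeff Fz i = 0" if "i \<ge> N" for i
  proof -
    have "degree (pderiv Q0) < N"
      using N monic_prod_linear(1)[of "{..<N}" "of_nat :: nat \<Rightarrow> 'a"] unfolding Q0_def degree_pderiv by simp
    then show ?thesis using that deg N unfolding Fz by (simp add: coeff_eq_0)
  qed
  have degD: "coeff (wderiv A s N) i = 0" if "i \<ge> N" for i
    using degree_wderiv_le[of A s N] that N by (intro coeff_eq_0) linarith
  \<comment> \<open>The coefficient with index \<open>N - 1\<close> of \<open>wderiv\<close> is the
    sum of the weights, whatever the points are, so \<open>lead\<close> makes it agree with that of
    \<open>Fz\<close>. This lowers the degree of the antiderivative \<open>J\<close> below
    \<open>N\<close>.\<close>
  have leadW: "coeff W (N - 1) = 0"
  proof -
    have "coeff (pderiv Q0) (N - 1) = of_nat N"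
      using coeff_wderiv[of "\<lambda>_. 1" "of_nat :: nat \<Rightarrow> 'a" N] unfolding wderiv_one Q0_def by simp
    moreover have "(\<Sum>r<N. A r) = of_nat N + fps_X * fps_const ((\<Sum>r<N. a r) - of_nat N)"
    proof -
      have "(\<Sum>r<N. fps_const (a r - 1)) = fps_const (\<Sum>r<N. a r - 1)"
        by (induction N) simp_all
      then show ?thesis unfolding A_def
        by (simp add: sum.distrib sum_distrib_left[symmetric] sum_subtractf)
    qed
    ultimately show ?thesis unfolding W_def coeff_diff coeff_wderiv Fz lead by (simp add: fps_of_nat)
  qed
  have coeffW: "coeff W i = 0" if "i \<ge> N - 1" for i
    using that leadW degFz degD by (cases "i = N - 1") (auto simp: W_def)
  define J where "J = (\<Sum>i<N. monom (coeff W i * fps_const (1 / of_nat (Suc i))) (Suc i))"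
  have coeffJ: "coeff J (Suc i) = coeff W i * fps_const (1 / of_nat (Suc i))" for i
    unfolding J_def coeff_sum using coeffW[of i] by (cases "i < N") (auto simp: if_distrib cong: if_cong)
  \<comment> \<open>The fixed-point equation gives \<open>J\<close> the \<open>N\<close> distinct
    roots \<open>0, ..., N - 1\<close>, more than its degree permits.\<close>
  have "J = 0"
  proof (rule poly_eqI_degree)
    fix x assume "x \<in> c ` {..<N}"
    then obtain r where r: "x = c r" "r < N" by auto
    have "poly J x = antideriv N (of_nat r) W"
      unfolding J_def antideriv_def r poly_sum poly_monom
      by (intro sum.cong refl) (simp add: c_def mult.assoc fps_const_power)
    then show "poly J x = poly 0 x" using W0[OF r(2)] by simp
  next
    have "inj_on c {..<N}" by (auto simp: inj_on_def c_def)
    then have card: "card (c ` {..<N}) = N" by (simp add: card_image)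
    show "degree 0 < card (c ` {..<N})" using N card by simp
    have "coeff J i = 0" if "i \<ge> N" for i
      using coeffJ[of "i - 1"] coeffW[of "i - 1"] that N by (cases i) auto
    then show "degree J < card (c ` {..<N})" unfolding card using N
      by (metis degree_0 leading_coeff_0_iff not_le_imp_less)
  qed
  then have "coeff W i = 0" for i using coeffJ[of i] by (simp del: of_nat_Suc)
  then have "coeff (wderiv A s N) i = coeff Fz i" for i by (simp add: W_def)
  then show ?thesis using that[of s] near_s unfolding near_def A_def Fz by blast
qed

section \<open>Polynomials with prescribed weighted derivative\<close>

lemma order_prod:
  fixes f :: "'b \<Rightarrow> 'a::idom poly"
  assumes "finite A" "\<And>i. i \<in> A \<Longrightarrow> f i \<noteq> 0"
  shows "order t (prod f A) = (\<Sum>i\<in>A. order t (f i))"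
  using assms
proof (induction A)
  case (insert a A)
  have "prod f A \<noteq> 0" "f a \<noteq> 0" using insert.hyps insert.prems by simp_all
  then have "order t (f a * prod f A) = order t (f a) + order t (prod f A)" by (intro order_mult) simp
  then show ?case using insert by simp
qed simp

lemma order_linear_power:
  fixes a :: "'a::idom"
  shows "order t ([:- a, 1:] ^ k) = (if a = t then k else 0)"
  by (auto simp: order_power_n_n intro: order_0I)

text \<open>This justifies the name \<open>wderiv\<close>: positive weights allow one factor fewer
  of each root to be taken out of every summand.\<close>

lemma pderiv_prod_linear_powers:
  fixes s :: "nat \<Rightarrow> 'a::idom"
  assumes w: "\<And>r. r < N \<Longrightarrow> w r > 0"
  shows "pderiv (\<Prod>r<N. [:- s r, 1:] ^ w r)
    = (\<Prod>r<N. [:- s r, 1:] ^ (w r - 1)) * wderiv (\<lambda>r. of_nat (w r)) s N"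
proof -
  have "pderiv (\<Prod>r<N. [:- s r, 1:] ^ w r)
      = (\<Sum>r<N. (\<Prod>q\<in>{..<N} - {r}. [:- s q, 1:] ^ w q) * pderiv ([:- s r, 1:] ^ w r))"
    by (rule pderiv_prod)
  also have "\<dots> = (\<Sum>r<N. (\<Prod>q<N. [:- s q, 1:] ^ (w q - 1))
      * smult (of_nat (w r)) (\<Prod>q\<in>{..<N} - {r}. [:- s q, 1:]))"
  proof (intro sum.cong refl)
    fix r assume r: "r \<in> {..<N}"
    have 1: "pderiv ([:- s r, 1:] ^ w r) = smult (of_nat (w r)) ([:- s r, 1:] ^ (w r - 1))"
      by (subst pderiv_power) (simp add: pderiv_pCons)
    have 2: "(\<Prod>q\<in>{..<N} - {r}. [:- s q, 1:] ^ w q)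
        = (\<Prod>q\<in>{..<N} - {r}. [:- s q, 1:] ^ (w q - 1)) * (\<Prod>q\<in>{..<N} - {r}. [:- s q, 1:])"
      unfolding prod.distrib[symmetric]
    proof (intro prod.cong refl)
      fix q assume "q \<in> {..<N} - {r}"
      then have "w q = Suc (w q - 1)" using w[of q] by auto
      then show "[:- s q, 1:] ^ w q = [:- s q, 1:] ^ (w q - 1) * [:- s q, 1:]"
        by (metis power_Suc2)
    qed
    have 3: "(\<Prod>q<N. [:- s q, 1:] ^ (w q - 1))
        = [:- s r, 1:] ^ (w r - 1) * (\<Prod>q\<in>{..<N} - {r}. [:- s q, 1:] ^ (w q - 1))"
      by (rule prod.remove) (use r in auto)
    show "(\<Prod>q\<in>{..<N} - {r}. [:- s q, 1:] ^ w q) * pderiv ([:- s r, 1:] ^ w r)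
        = (\<Prod>q<N. [:- s q, 1:] ^ (w q - 1)) * smult (of_nat (w r)) (\<Prod>q\<in>{..<N} - {r}. [:- s q, 1:])"
      unfolding 1 2 3 mult_smult_right by (simp only: mult_ac)
  qed
  finally show ?thesis unfolding wderiv_def sum_distrib_left .
qed

text \<open>In characteristic zero differentiation lowers the order of \<open>P\<close> at a root by
  exactly one. The factor \<open>Q\<close> accounts for the sum of all \<open>w r - 1\<close> over
  the points at \<open>t\<close>, which leaves the number of these points minus one.\<close>

lemma order_wderiv:
  fixes s :: "nat \<Rightarrow> 'a::field_char_0"
  assumes w: "\<And>r. r < N \<Longrightarrow> w r > 0" and t: "r0 < N" "s r0 = t"
  shows "Suc (order t (wderiv (\<lambda>r. of_nat (w r)) s N)) = card {r\<in>{..<N}. s r = t}"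
proof -
  define D where "D = wderiv (\<lambda>r. of_nat (w r)) s N"
  define P where "P = (\<Prod>r<N. [:- s r, 1:] ^ w r)"
  define Q where "Q = (\<Prod>r<N. [:- s r, 1:] ^ (w r - 1))"
  define Z where "Z = {r\<in>{..<N}. s r = t}"
  have Z: "finite Z" "r0 \<in> Z" unfolding Z_def using t by auto
  have "(\<Sum>r<N. w r) > 0" using w t(1) by (intro sum_pos) auto
  then have "coeff D (N - 1) \<noteq> 0"
    unfolding D_def coeff_wderiv using of_nat_sum[of w "{..<N}", where ?'a = 'a]
    by (metis of_nat_0_eq_iff less_irrefl)
  then have D: "D \<noteq> 0" by auto
  have Q: "Q \<noteq> 0" unfolding Q_def by auto
  have P': "pderiv P = Q * D" unfolding P_def Q_def D_def by (rule pderiv_prod_linear_powers[OF w])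
  have restrict: "(\<Sum>r<N. if s r = t then f r else 0) = sum f Z" for f :: "nat \<Rightarrow> nat"
    unfolding Z_def by (rule sum.inter_filter[symmetric]) simp
  have oP: "order t P = (\<Sum>r\<in>Z. w r)"
    unfolding P_def by (subst order_prod) (auto simp: order_linear_power restrict)
  have oQ: "order t Q = (\<Sum>r\<in>Z. w r - 1)"
    unfolding Q_def by (subst order_prod) (auto simp: order_linear_power restrict)
  have split: "(\<Sum>r\<in>Z. w r) = (\<Sum>r\<in>Z. w r - 1) + card Z"
  proof -
    have "(\<Sum>r\<in>Z. w r) = (\<Sum>r\<in>Z. (w r - 1) + 1)"
    proof (intro sum.cong refl)
      fix r assume "r \<in> Z" then show "w r = w r - 1 + 1" using w[of r] unfolding Z_def by auto
    qed
    then show ?thesis by (simp only: sum.distrib sum_constant) simp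
  qed
  have "card Z > 0" using Z card_gt_0_iff by blast
  then have "order t P \<noteq> 0" unfolding oP split by simp
  then have "poly P t = 0" by (simp add: order_root)
  moreover have "P \<noteq> 0" unfolding P_def by auto
  ultimately have "order t P = Suc (order t (pderiv P))" by (intro order_pderiv)
  also have "order t (pderiv P) = order t Q + order t D"
    unfolding P' using Q D by (intro order_mult) simp
  finally have "order t P = Suc (order t Q + order t D)" .
  then show ?thesis using oP oQ split unfolding D_def[symmetric] Z_def[symmetric] by linarith
qed

text \<open>The rigidity behind both limit arguments: order \<open>N - 1\<close> at a point of the
  family forces all \<open>N\<close> points to coincide there.\<close>

lemma wderiv_pure_power:
  fixes s :: "nat \<Rightarrow> 'a::field_char_0"
  assumes w: "\<And>r. r < N \<Longrightarrow> w r > 0"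
    and D: "wderiv (\<lambda>r. of_nat (w r)) s N = smult d ([:- t, 1:] ^ (N - 1))"
    and t: "r0 < N" "s r0 = t" and r: "r < N"
  shows "s r = t"
proof -
  have "(\<Sum>r<N. w r) > 0" using w r by (intro sum_pos) auto
  then have "coeff (wderiv (\<lambda>r. of_nat (w r)) s N) (N - 1) \<noteq> 0"
    unfolding coeff_wderiv using of_nat_sum[of w "{..<N}", where ?'a = 'a]
    by (metis of_nat_0_eq_iff less_irrefl)
  then have "d \<noteq> 0" unfolding D by auto
  then have "order t (wderiv (\<lambda>r. of_nat (w r)) s N) = N - 1"
    unfolding D by (simp add: order_smult order_power_n_n)
  moreover have "Suc (order t (wderiv (\<lambda>r. of_nat (w r)) s N)) = card {r\<in>{..<N}. s r = t}"
    by (rule order_wderiv) (use w t in auto)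
  ultimately have "card {r\<in>{..<N}. s r = t} = card {..<N}" using r by simp
  then have "{r\<in>{..<N}. s r = t} = {..<N}" by (intro card_subset_eq) auto
  then show ?thesis using r by blast
qed

section \<open>Homogeneity and functoriality of the weighted derivative\<close>

lemma poly_wderiv: "poly (wderiv a s N) x = (\<Sum>r<N. a r * (\<Prod>q\<in>{..<N} - {r}. x - s q))"
  unfolding wderiv_def by (simp add: poly_sum poly_prod)

lemma poly_wderiv_scale:
  "poly (wderiv a (\<lambda>r. c * s r) N) (c * x) = c ^ (N - 1) * poly (wderiv a s N) x"
  unfolding poly_wderiv sum_distrib_left
proof (intro sum.cong refl)
  fix r assume "r \<in> {..<N}"
  then have "card ({..<N} - {r}) = N - 1" by simp
  then have "(\<Prod>q\<in>{..<N} - {r}. c * x - c * s q) = c ^ (N - 1) * (\<Prod>q\<in>{..<N} - {r}. x - s q)"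
    by (simp add: right_diff_distrib[symmetric] prod.distrib)
  then show "a r * (\<Prod>q\<in>{..<N} - {r}. c * x - c * s q) = c ^ (N - 1) * (a r * (\<Prod>q\<in>{..<N} - {r}. x - s q))"
    by (simp add: mult_ac)
qed

lemma coeff_wderiv_scale:
  fixes s :: "nat \<Rightarrow> 'a::field_char_0"
  assumes c: "c \<noteq> 0" and i: "i \<le> N - 1"
  shows "coeff (wderiv a (\<lambda>r. c * s r) N) i = c ^ (N - 1 - i) * coeff (wderiv a s N) i"
proof -
  have "pcompose (wderiv a (\<lambda>r. c * s r) N) [:0, c:] = smult (c ^ (N - 1)) (wderiv a s N)"
    by (rule poly_ext) (simp add: poly_pcompose mult.commute[of _ c] poly_wderiv_scale)
  then have "coeff (pcompose (wderiv a (\<lambda>r. c * s r) N) [:0, c:]) i = c ^ (N - 1) * coeff (wderiv a s N) i"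
    by simp
  moreover have "c ^ (N - 1) = c ^ i * c ^ (N - 1 - i)"
    using i by (simp only: power_add[symmetric] le_add_diff_inverse)
  ultimately have "c ^ i * coeff (wderiv a (\<lambda>r. c * s r) N) i = c ^ i * (c ^ (N - 1 - i) * coeff (wderiv a s N) i)"
    by (simp only: coeff_pcompose_linear mult.assoc)
  then show ?thesis using c by simp
qed

text \<open>The coefficients are integer polynomials in the weights and points, hence compatible
  with every subring of a product ring. Places and ordinary homomorphisms are both covered.\<close>

lemma wderiv_rel:
  assumes H: "subring_rel H" and "\<And>r. r < N \<Longrightarrow> (a r, a' r) \<in> H" "\<And>r. r < N \<Longrightarrow> (s r, s' r) \<in> H"
  shows "(coeff (wderiv a s N) i, coeff (wderiv a' s' N) i) \<in> H"
proof -
  have P: "subring_rel (poly_rel H)" using H by (rule subring_poly_rel)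
  have "(\<Sum>r<N. [:a r:] * (\<Prod>q\<in>{..<N} - {r}. [:- s q, 1:]),
      \<Sum>r<N. [:a' r:] * (\<Prod>q\<in>{..<N} - {r}. [:- s' q, 1:])) \<in> poly_rel H"
  proof (intro subring_rel_sum[OF P] subring_rel_mult[OF P] subring_rel_prod[OF P])
    fix r assume "r \<in> {..<N}"
    then show "([:a r:], [:a' r:]) \<in> poly_rel H" using assms by (intro poly_rel_const) auto
  next
    fix r q assume "q \<in> {..<N} - {r}"
    then show "([:- s q, 1:], [:- s' q, 1:]) \<in> poly_rel H"
      using assms by (intro poly_rel_pCons poly_rel_const subring_rel_uminus subring_rel_one poly_rel_0) auto
  qed
  then show ?thesis unfolding wderiv_def poly_rel_def by simp
qed

lemma coeff_wderiv_hom: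
  assumes "comm_ring_hom h"
  shows "coeff (wderiv (\<lambda>r. h (a r)) (\<lambda>r. h (s r)) N) i = h (coeff (wderiv a s N) i)"
proof -
  interpret comm_ring_hom h by fact
  have "subring_rel {(x, h x) | x. True}" unfolding subring_rel_def by (auto simp: hom_distribs)
  then have "(coeff (wderiv a s N) i, coeff (wderiv (\<lambda>r. h (a r)) (\<lambda>r. h (s r)) N) i)
      \<in> {(x, h x) | x. True}" by (rule wderiv_rel) auto
  then show ?thesis by simp
qed

text \<open>A place over \<open>z = 1\<close> specialises the formal solution. Since its entries may
  be infinite there, they are first divided by a dominating element \<open>y\<close>, and
  homogeneity keeps track of this scaling.\<close>

theorem weighted_derivative_surjective:
  fixes F :: "'a::{alg_closed_field, field_char_0} poly"
  assumes N: "N > 0" and w: "\<And>r. r < N \<Longrightarrow> w r > 0"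
    and deg: "degree F \<le> N - 1" and lead: "coeff F (N - 1) = (\<Sum>r<N. of_nat (w r))"
  obtains s where "s 0 = 0" "wderiv (\<lambda>r. of_nat (w r)) s N = F"
proof -
  define a :: "nat \<Rightarrow> 'a" where "a r = of_nat (w r)" for r
  define Q0 where "Q0 = (\<Prod>q<N. [:- of_nat q, 1:] :: 'a poly)"
  obtain z where z0: "z 0 = 0" and z: "\<And>i. coeff (wderiv (\<lambda>r. 1 + fps_X * fps_const (a r - 1)) z N) i
      = fps_const (coeff (pderiv Q0) i) + fps_X * fps_const (coeff F i - coeff (pderiv Q0) i)"
    using formal_weight_deformation[OF N deg, of a] lead unfolding a_def Q0_def by blast
  \<comment> \<open>Evaluation at \<open>1\<close> makes sense only for polynomials among the
    Laurent series; the place extends it.\<close>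
  define G :: "('a fls \<times> 'a) set" where "G = {(fps_to_fls (fps_of_poly p), poly p 1) | p. True}"
  have "partial_hom G"
    unfolding partial_hom_def subring_rel_def
  proof (intro conjI allI impI)
    have "(fps_to_fls (fps_of_poly 1), poly 1 1) \<in> G" unfolding G_def by blast
    then show "(1, 1) \<in> G" by simp
  next
    fix x y u v assume "(x, y) \<in> G" "(u, v) \<in> G"
    then obtain p q where pq: "x = fps_to_fls (fps_of_poly p)" "y = poly p 1"
      "u = fps_to_fls (fps_of_poly q)" "v = poly q 1" unfolding G_def by blast
    have "(fps_to_fls (fps_of_poly (p - q)), poly (p - q) 1) \<in> G"
      "(fps_to_fls (fps_of_poly (p * q)), poly (p * q) 1) \<in> G" unfolding G_def by blast+
    then show "(x - u, y - v) \<in> G" "(x * u, y * v) \<in> G"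
      by (simp_all add: pq fps_of_poly_diff fps_of_poly_mult fls_times_fps_to_fls)
  next
    fix y assume "(0, y) \<in> G"
    then obtain p where p: "0 = fps_to_fls (fps_of_poly p)" "y = poly p 1" unfolding G_def by blast
    then have "fps_of_poly p = fps_of_poly 0" using fps_to_fls_eq_0_iff[of "fps_of_poly p"] by simp
    then show "y = 0" unfolding p(2) fps_of_poly_eq_iff by simp
  qed
  moreover have lin: "(fps_to_fls (fps_const x + fps_X * fps_const y), x + y) \<in> G" for x y
  proof -
    have "(fps_to_fls (fps_of_poly [:x, y:]), poly [:x, y:] 1) \<in> G" unfolding G_def by blast
    then show ?thesis by (simp add: fps_of_poly_pCons mult.commute)
  qed
  have "(fls_const c, c) \<in> G" for c using lin[of c 0] by simp
  ultimately obtain H where GH: "G \<subseteq> H" and "place H fls_const" by (rule place_extension)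
  then interpret place H fls_const by simp
  define A where "A r = fps_to_fls (1 + fps_X * fps_const (a r - 1))" for r
  define \<sigma> where "\<sigma> r = fps_to_fls (z r)" for r
  have AH: "(A r, a r) \<in> H" for r using lin[of 1 "a r - 1"] GH unfolding A_def by auto
  define Fz where "Fz i = fps_to_fls (fps_const (coeff (pderiv Q0) i) + fps_X * fps_const (coeff F i - coeff (pderiv Q0) i))" for i
  have FH: "(Fz i, coeff F i) \<in> H" for i
    using lin[of "coeff (pderiv Q0) i" "coeff F i - coeff (pderiv Q0) i"] GH unfolding Fz_def by auto
  have \<sigma>: "coeff (wderiv A \<sigma> N) i = Fz i" for i
  proof -
    have "comm_ring_hom (fps_to_fls :: 'a fps \<Rightarrow> 'a fls)"
      by unfold_locales (simp_all add: fls_times_fps_to_fls)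
    then show ?thesis unfolding A_def \<sigma>_def Fz_def z[symmetric] by (rule coeff_wderiv_hom)
  qed
  \<comment> \<open>Including \<open>1\<close> in the set ensures that \<open>1 / y\<close> also has
    a finite value \<open>\<gamma>\<close>, which measures the scaling.\<close>
  obtain y where y: "y \<in> insert 1 (\<sigma> ` {..<N})" "y \<noteq> 0"
    and dom: "\<And>x. x \<in> insert 1 (\<sigma> ` {..<N}) \<Longrightarrow> \<exists>t. (x / y, t) \<in> H"
    using dominating_element[of "insert 1 (\<sigma> ` {..<N})" 1] by auto
  obtain \<gamma> where \<gamma>: "(1 / y, \<gamma>) \<in> H" using dom[of 1] by blast
  have "\<forall>r. \<exists>t. r < N \<longrightarrow> (\<sigma> r / y, t) \<in> H" using dom by blast
  then obtain t where t: "\<And>r. r < N \<Longrightarrow> (\<sigma> r / y, t r) \<in> H" by metis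
  have coeff_t: "coeff (wderiv a t N) i = \<gamma> ^ (N - 1 - i) * coeff F i" if i: "i \<le> N - 1" for i
  proof -
    have "(coeff (wderiv A (\<lambda>r. 1 / y * \<sigma> r) N) i, coeff (wderiv a t N) i) \<in> H"
      using t AH by (intro wderiv_rel sub) auto
    moreover have "coeff (wderiv A (\<lambda>r. 1 / y * \<sigma> r) N) i = (1 / y) ^ (N - 1 - i) * Fz i"
      unfolding \<sigma>[symmetric] using y(2) i by (intro coeff_wderiv_scale) auto
    moreover have "((1 / y) ^ (N - 1 - i) * Fz i, \<gamma> ^ (N - 1 - i) * coeff F i) \<in> H"
      by (intro subring_rel_mult[OF sub] subring_rel_power[OF sub] \<gamma> FH)
    ultimately show ?thesis using partial_hom_unique[OF hom] by metis
  qed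
  have t0: "t 0 = 0"
    using t[OF N] subring_rel_zero[OF sub] partial_hom_unique[OF hom] by (auto simp: \<sigma>_def z0)
  have degD: "coeff (wderiv b u N) i = 0" if "i > N - 1" for i b and u :: "nat \<Rightarrow> 'a"
    using degree_wderiv_le[of b u N] that by (intro coeff_eq_0) linarith
  \<comment> \<open>For \<open>\<gamma> = 0\<close> only the leading coefficient survives, so the
    rescaled points would all be \<open>0\<close>; but \<open>y\<close> is then one of the original
    points and its rescaled value is \<open>1\<close>.\<close>
  have "\<gamma> \<noteq> 0"
  proof
    assume \<gamma>0: "\<gamma> = 0"
    then have "y \<noteq> 1" using \<gamma> subring_rel_one[OF sub] partial_hom_unique[OF hom] by force
    then obtain j where j: "j < N" "y = \<sigma> j" using y(1) by auto
    then have "t j = 1"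
      using t[OF j(1)] y(2) subring_rel_one[OF sub] partial_hom_unique[OF hom] by force
    moreover have "wderiv a t N = smult (coeff F (N - 1)) ([:- 0, 1:] ^ (N - 1))"
    proof (rule poly_eqI)
      fix i
      show "coeff (wderiv a t N) i = coeff (smult (coeff F (N - 1)) ([:- 0, 1:] ^ (N - 1))) i"
        using coeff_t[of i] degD[of i] \<gamma>0
        by (cases "i < N - 1"; cases "i = N - 1") (auto simp: monom_altdef[of 1, simplified, symmetric])
    qed
    then have "t j = 0"
      unfolding a_def by (intro wderiv_pure_power[where s = t, OF w _ N t0 j(1)])
    ultimately show False by simp
  qed
  then have inv: "1 / \<gamma> \<noteq> 0" by simp
  \<comment> \<open>Dividing by the nonzero \<open>\<gamma>\<close> undoes the
    normalisation.\<close>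
  have "wderiv a (\<lambda>r. 1 / \<gamma> * t r) N = F"
  proof (rule poly_eqI)
    fix i
    show "coeff (wderiv a (\<lambda>r. 1 / \<gamma> * t r) N) i = coeff F i"
    proof (cases "i \<le> N - 1")
      case True
      show ?thesis unfolding coeff_wderiv_scale[OF inv True] coeff_t[OF True]
        using \<open>\<gamma> \<noteq> 0\<close> by (simp add: power_divide)
    next
      case False
      then show ?thesis using degD[of i] deg by (simp add: coeff_eq_0)
    qed
  qed
  then show ?thesis using that[of "\<lambda>r. 1 / \<gamma> * t r"] t0 unfolding a_def by simp
qed

section \<open>Separating zeros and critical points\<close>

text \<open>The subsequence is thinned out once for each of the finitely many coordinates.\<close>

lemma convergent_subsequence_finite_family:
  fixes f :: "nat \<Rightarrow> nat \<Rightarrow> complex"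
  assumes "\<And>n r. norm (f n r) \<le> B"
  obtains g l where "strict_mono (g :: nat \<Rightarrow> nat)" "\<And>r. r < N \<Longrightarrow> (\<lambda>n. f (g n) r) \<longlonglongrightarrow> l r"
proof -
  have "\<exists>g l. strict_mono (g :: nat \<Rightarrow> nat) \<and> (\<forall>r<N. (\<lambda>n. f (g n) r) \<longlonglongrightarrow> l r)"
  proof (induction N)
    case 0 show ?case by (rule exI[of _ id]) (auto simp: strict_mono_def)
  next
    case (Suc N)
    then obtain g l where g: "strict_mono (g :: nat \<Rightarrow> nat)" "\<And>r. r < N \<Longrightarrow> (\<lambda>n. f (g n) r) \<longlonglongrightarrow> l r"
      by blast
    have "\<forall>n. norm (f (g n) N) \<le> B" using assms by simp
    then obtain h z where h: "strict_mono (h :: nat \<Rightarrow> nat)"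
      and z: "\<forall>e>0. \<exists>M. \<forall>n\<ge>M. norm (f (g (h n)) N - z) < e"
      using Bolzano_Weierstrass_complex_disc[of "\<lambda>n. f (g n) N" B] by blast
    have "(\<lambda>n. f (g (h n)) N) \<longlonglongrightarrow> z" using z by (intro LIMSEQ_I) simp
    moreover have "(\<lambda>n. f (g (h n)) r) \<longlonglongrightarrow> l r" if "r < N" for r
      using LIMSEQ_subseq_LIMSEQ[OF g(2)[OF that] h] by (simp add: o_def)
    ultimately have "\<forall>r<Suc N. (\<lambda>n. f ((g \<circ> h) n) r) \<longlonglongrightarrow> (l(N := z)) r"
      by (auto simp: less_Suc_eq)
    then show ?case using strict_mono_o[OF g(1) h] by blast
  qed
  then show ?thesis using that by blast
qed

text \<open>Otherwise every \<open>\<nu>\<close> has a solution in which a zero meets a critical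
  point. After normalisation a subsequence converges, and all critical points merge into one limit
  \<open>\<rho>\<close> that is also a zero. Rigidity moves every zero to \<open>\<rho>\<close>;
  since one of them is \<open>0\<close>, all are \<open>0\<close>, against the
  normalisation.\<close>

lemma far_critical_points_avoid_zeros:
  fixes d :: complex
  assumes N: "N > 0" and w: "\<And>r. r < N \<Longrightarrow> w r > 0" and \<beta>: "(\<Sum>i=1..k. \<beta> i) = N - 1"
  obtains \<nu> :: nat where "\<And>s r i. s 0 = 0 \<Longrightarrow>
      wderiv (\<lambda>r. of_nat (w r)) s N = smult d (\<Prod>i=1..k. [:- of_nat (\<nu> + i), 1:] ^ \<beta> i) \<Longrightarrow>
      r < N \<Longrightarrow> i \<in> {1..k} \<Longrightarrow> s r \<noteq> of_nat (\<nu> + i)"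
proof -
  define a :: "nat \<Rightarrow> complex" where "a r = of_nat (w r)" for r
  define sol where "sol \<nu> s \<longleftrightarrow> s 0 = 0 \<and> wderiv a s N = smult d (\<Prod>i=1..k. [:- of_nat (\<nu> + i), 1:] ^ \<beta> i)"
    for \<nu> :: nat and s
  have "\<exists>\<nu>. \<forall>s r i. sol \<nu> s \<longrightarrow> r < N \<longrightarrow> i \<in> {1..k} \<longrightarrow> s r \<noteq> of_nat (\<nu> + i)"
  proof (rule ccontr)
    assume "\<not> ?thesis"
    then have "\<forall>\<nu>. \<exists>s r i. sol \<nu> s \<and> r < N \<and> i \<in> {1..k} \<and> s r = of_nat (\<nu> + i)" by blast
    then obtain S rr ii where S: "\<And>\<nu>. sol \<nu> (S \<nu>)" "\<And>\<nu>. rr \<nu> < N" "\<And>\<nu>. ii \<nu> \<in> {1..k}"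
      "\<And>\<nu>. S \<nu> (rr \<nu>) = of_nat (\<nu> + ii \<nu>)" by metis
    define R where "R \<nu> = (\<Sum>r<N. norm (S \<nu> r))" for \<nu>
    have S_le: "norm (S \<nu> r) \<le> R \<nu>" if "r < N" for r \<nu>
      unfolding R_def using that by (intro member_le_sum) auto
    have R_ge: "real \<nu> + 1 \<le> R \<nu>" for \<nu>
    proof -
      have "norm (S \<nu> (rr \<nu>)) = real (\<nu> + ii \<nu>)" unfolding S(4) by (rule norm_of_nat)
      then show ?thesis using S_le[OF S(2)[of \<nu>], of \<nu>] S(3)[of \<nu>] by simp
    qed
    have R_pos: "R \<nu> > 0" for \<nu> using R_ge[of \<nu>] by linarith
    \<comment> \<open>The coordinate \<open>N\<close> carries the normalised position of the
      critical points, so that one subsequence serves for them and for the zeros.\<close>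
    define f where "f \<nu> r = (if r < N then S \<nu> r / of_real (R \<nu>) else of_real (real \<nu> / R \<nu>))" for \<nu> r
    have "norm (f \<nu> r) \<le> 1" for \<nu> r
    proof (cases "r < N")
      case True
      then show ?thesis using S_le[OF True, of \<nu>] R_pos[of \<nu>] by (simp add: f_def norm_divide)
    next
      case False
      then show ?thesis using R_ge[of \<nu>] R_pos[of \<nu>] by (simp add: f_def norm_divide)
    qed
    then obtain g l where g: "strict_mono (g :: nat \<Rightarrow> nat)"
      and l: "\<And>r. r < Suc N \<Longrightarrow> (\<lambda>n. f (g n) r) \<longlonglongrightarrow> l r"
      using convergent_subsequence_finite_family[of f 1 "Suc N"] by blast
    define \<rho> where "\<rho> = l N"
    have l': "(\<lambda>n. S (g n) r / of_real (R (g n))) \<longlonglongrightarrow> l r" if "r < N" for r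
      using l[of r] that by (simp add: f_def)
    have \<rho>: "(\<lambda>n. of_real (real (g n) / R (g n))) \<longlonglongrightarrow> \<rho>"
      using l[of N] by (simp add: f_def \<rho>_def)
    have "(\<lambda>\<nu>. 1 / R \<nu>) \<longlonglongrightarrow> 0"
    proof (rule tendsto_sandwich[of "\<lambda>_. 0" _ _ "\<lambda>\<nu>. inverse (real (Suc \<nu>))"])
      show "\<forall>\<^sub>F \<nu> in sequentially. 0 \<le> 1 / R \<nu>"
        using R_pos by (intro always_eventually allI) (simp add: less_imp_le)
      show "\<forall>\<^sub>F \<nu> in sequentially. 1 / R \<nu> \<le> inverse (real (Suc \<nu>))"
        using R_pos R_ge by (intro always_eventually allI) (simp add: field_simps)
      show "(\<lambda>\<nu>. inverse (real (Suc \<nu>))) \<longlonglongrightarrow> 0" by (rule LIMSEQ_inverse_real_of_nat)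
    qed simp
    then have "(\<lambda>n. 1 / R (g n)) \<longlonglongrightarrow> 0" using LIMSEQ_subseq_LIMSEQ[OF _ g] by (simp add: o_def)
    then have "(\<lambda>n. complex_of_real (1 / R (g n))) \<longlonglongrightarrow> of_real 0" by (rule tendsto_of_real)
    then have invR: "(\<lambda>n. of_real (1 / R (g n))) \<longlonglongrightarrow> (0 :: complex)" by (simp only: of_real_0)
    \<comment> \<open>The bounded distances between the critical points vanish in the limit, because
      \<open>R\<close> grows at least like \<open>\<nu>\<close>.\<close>
    have shift: "(\<lambda>n. of_nat (g n + i) / of_real (R (g n))) \<longlonglongrightarrow> \<rho>" for i
    proof -
      have "(\<lambda>n. of_real (real (g n) / R (g n)) + of_nat i * of_real (1 / R (g n))) \<longlonglongrightarrow> \<rho> + of_nat i * 0"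
        by (intro tendsto_intros \<rho> invR)
      then show ?thesis by (simp add: add_divide_distrib)
    qed
    have "poly (wderiv a l N) x = poly (smult d ([:- \<rho>, 1:] ^ (N - 1))) x" for x
    proof -
      have eq: "poly (wderiv a (\<lambda>r. S \<nu> r / of_real (R \<nu>)) N) x
          = d * (\<Prod>i=1..k. (x - of_nat (\<nu> + i) / of_real (R \<nu>)) ^ \<beta> i)" for \<nu>
      proof -
        define c :: complex where "c = 1 / of_real (R \<nu>)"
        have c0: "c \<noteq> 0" and cR: "c * of_real (R \<nu>) = 1" using R_pos[of \<nu>] by (auto simp: c_def)
        have "poly (wderiv a (\<lambda>r. c * S \<nu> r) N) (c * (of_real (R \<nu>) * x))
            = c ^ (N - 1) * poly (wderiv a (S \<nu>) N) (of_real (R \<nu>) * x)"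
          by (rule poly_wderiv_scale)
        also have "c * (of_real (R \<nu>) * x) = x" using cR by (simp flip: mult.assoc)
        also have "poly (wderiv a (S \<nu>) N) (of_real (R \<nu>) * x)
            = d * (\<Prod>i=1..k. (of_real (R \<nu>) * x - of_nat (\<nu> + i)) ^ \<beta> i)"
          using S(1)[of \<nu>] unfolding sol_def by (simp add: poly_prod del: of_nat_add)
        also have "c ^ (N - 1) * (d * (\<Prod>i=1..k. (of_real (R \<nu>) * x - of_nat (\<nu> + i)) ^ \<beta> i))
            = d * (\<Prod>i=1..k. c ^ \<beta> i * (of_real (R \<nu>) * x - of_nat (\<nu> + i)) ^ \<beta> i)"
          unfolding prod.distrib power_sum[symmetric] \<beta> by simp
        also have "(\<Prod>i=1..k. c ^ \<beta> i * (of_real (R \<nu>) * x - of_nat (\<nu> + i)) ^ \<beta> i)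
            = (\<Prod>i=1..k. (x - of_nat (\<nu> + i) / of_real (R \<nu>)) ^ \<beta> i)"
        proof (intro prod.cong refl)
          fix i
          have "c * (of_real (R \<nu>) * x - of_nat (\<nu> + i)) = x - of_nat (\<nu> + i) / of_real (R \<nu>)"
            using R_pos[of \<nu>] unfolding c_def by (simp add: field_simps)
          then show "c ^ \<beta> i * (of_real (R \<nu>) * x - of_nat (\<nu> + i)) ^ \<beta> i
              = (x - of_nat (\<nu> + i) / of_real (R \<nu>)) ^ \<beta> i"
            by (simp only: power_mult_distrib[symmetric])
        qed
        finally show ?thesis by (simp add: c_def)
      qed
      have "(\<lambda>n. poly (wderiv a (\<lambda>r. S (g n) r / of_real (R (g n))) N) x) \<longlonglongrightarrow> poly (wderiv a l N) x"
        unfolding poly_wderiv by (intro tendsto_intros l') auto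
      moreover have "(\<lambda>n. poly (wderiv a (\<lambda>r. S (g n) r / of_real (R (g n))) N) x)
          \<longlonglongrightarrow> d * (\<Prod>i=1..k. (x - \<rho>) ^ \<beta> i)"
        unfolding eq by (intro tendsto_intros shift)
      ultimately have "poly (wderiv a l N) x = d * (\<Prod>i=1..k. (x - \<rho>) ^ \<beta> i)"
        by (rule LIMSEQ_unique)
      then show ?thesis unfolding power_sum[symmetric] \<beta> by simp
    qed
    then have lim: "wderiv a l N = smult d ([:- \<rho>, 1:] ^ (N - 1))" by (intro poly_ext)
    \<comment> \<open>The indices of the colliding pair depend on \<open>\<nu>\<close>. A product
      over all pairs expresses the collision in a form that passes to the limit.\<close>
    have collide: "(\<Prod>r<N. \<Prod>i=1..k. S \<nu> r / of_real (R \<nu>) - of_nat (\<nu> + i) / of_real (R \<nu>)) = 0" for \<nu>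
    proof (rule prod_zero)
      show "\<exists>r\<in>{..<N}. (\<Prod>i=1..k. S \<nu> r / of_real (R \<nu>) - of_nat (\<nu> + i) / of_real (R \<nu>)) = 0"
      proof (rule bexI[of _ "rr \<nu>"], rule prod_zero)
        show "\<exists>i\<in>{1..k}. S \<nu> (rr \<nu>) / of_real (R \<nu>) - of_nat (\<nu> + i) / of_real (R \<nu>) = 0"
          using S(3,4)[of \<nu>] by (intro bexI[of _ "ii \<nu>"]) auto
      qed (use S(2) in auto)
    qed simp
    have "(\<lambda>n. \<Prod>r<N. \<Prod>i=1..k. S (g n) r / of_real (R (g n)) - of_nat (g n + i) / of_real (R (g n)))
        \<longlonglongrightarrow> (\<Prod>r<N. \<Prod>i=1..k. l r - \<rho>)"
      by (intro tendsto_intros l' shift) auto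
    then have "(\<lambda>n. 0) \<longlonglongrightarrow> (\<Prod>r<N. \<Prod>i=1..k. l r - \<rho>)" by (simp only: collide)
    then have "(\<Prod>r<N. \<Prod>i=1..k. l r - \<rho>) = 0" by (simp only: LIMSEQ_const_iff)
    then obtain r0 where r0: "r0 < N" "l r0 = \<rho>" by (auto simp: prod_zero_iff)
    have all: "l r = \<rho>" if "r < N" for r
      using lim unfolding a_def by (intro wderiv_pure_power[where s = l, OF w _ r0 that])
    have "l 0 = 0"
      using l'[OF N] S(1) unfolding sol_def by (simp add: LIMSEQ_const_iff)
    then have zero: "l r = 0" if "r < N" for r using all[OF that] all[OF N] by simp
    have "(\<Sum>r<N. norm (S \<nu> r / of_real (R \<nu>))) = 1" for \<nu>
      using R_pos[of \<nu>] by (simp add: norm_divide sum_divide_distrib[symmetric] R_def[symmetric])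
    moreover have "(\<lambda>n. \<Sum>r<N. norm (S (g n) r / of_real (R (g n)))) \<longlonglongrightarrow> (\<Sum>r<N. norm (l r))"
      by (intro tendsto_intros l') auto
    ultimately show False using zero by (simp add: LIMSEQ_const_iff)
  qed
  then show ?thesis using that unfolding sol_def a_def by blast
qed

text \<open>The equation is solved over the given field; the embedding into \<open>complex\<close>
  serves only to select natural numbers as critical points that no solution can meet.\<close>

theorem separated_zeros_and_critical_points:
  fixes emb :: "'a::{alg_closed_field, field_char_0} \<Rightarrow> complex"
  assumes emb: "field_hom emb"
    and N: "N > 0" and w: "\<And>r. r < N \<Longrightarrow> w r > 0" and \<beta>: "(\<Sum>i=1..k. \<beta> i) = N - 1"
  obtains s mu :: "nat \<Rightarrow> 'a" where "inj_on s {..<N}" "inj_on mu {1..k}"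
    "s ` {..<N} \<inter> mu ` {1..k} = {}"
    "wderiv (\<lambda>r. of_nat (w r)) s N = smult (of_nat (\<Sum>r<N. w r)) (\<Prod>i=1..k. [:- mu i, 1:] ^ \<beta> i)"
proof -
  interpret field_hom emb by fact
  define d where "d = (\<Sum>r<N. w r)"
  obtain \<nu> where \<nu>: "\<And>s r i. s 0 = 0 \<Longrightarrow> wderiv (\<lambda>r. of_nat (w r)) s N
        = smult (of_nat d :: complex) (\<Prod>i=1..k. [:- of_nat (\<nu> + i), 1:] ^ \<beta> i) \<Longrightarrow>
      r < N \<Longrightarrow> i \<in> {1..k} \<Longrightarrow> s r \<noteq> of_nat (\<nu> + i)"
    using far_critical_points_avoid_zeros[where w = w and d = "of_nat d", OF N w \<beta>] by blast
  define E where "E = (\<Prod>i=1..k. [:- of_nat (\<nu> + i), 1:] ^ \<beta> i :: 'a poly)"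
  have E_monic: "lead_coeff E = 1" unfolding E_def by (simp add: lead_coeff_prod lead_coeff_power)
  have "degree E = (\<Sum>i=1..k. degree ([:- of_nat (\<nu> + i), 1:] ^ \<beta> i :: 'a poly))"
    unfolding E_def by (rule degree_prod_eq_sum_degree) auto
  also have "\<dots> = N - 1" unfolding \<beta>[symmetric] by (intro sum.cong refl) (simp add: degree_power_eq)
  finally have E_deg: "degree E = N - 1" .
  obtain s where s0: "s 0 = 0" and s: "wderiv (\<lambda>r. of_nat (w r)) s N = smult (of_nat d) E"
  proof (rule weighted_derivative_surjective[where w = w and F = "smult (of_nat d) E", OF N w])
    show "degree (smult (of_nat d) E) \<le> N - 1" using degree_smult_le[of "of_nat d" E] E_deg by simp
    show "coeff (smult (of_nat d) E) (N - 1) = (\<Sum>r<N. of_nat (w r))"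
      using E_monic E_deg by (simp add: d_def)
  qed auto
  have ne: "s r \<noteq> of_nat (\<nu> + i)" if r: "r < N" and i: "i \<in> {1..k}" for r i
  proof -
    have "wderiv (\<lambda>r. emb (of_nat (w r))) (\<lambda>r. emb (s r)) N = map_poly emb (smult (of_nat d) E)"
      by (rule poly_eqI) (simp only: coeff_wderiv_hom[OF comm_ring_hom_axioms] coeff_map_poly hom_zero s)
    also have "\<dots> = smult (of_nat d) (\<Prod>i=1..k. [:- of_nat (\<nu> + i), 1:] ^ \<beta> i)"
    proof (rule poly_eqI)
      define G where "G = {(x, emb x) | x. True}"
      have G: "subring_rel G" unfolding G_def subring_rel_def by (auto simp: hom_distribs)
      have P: "subring_rel (poly_rel G)" using G by (rule subring_poly_rel)
      have "(E, \<Prod>i=1..k. [:- of_nat (\<nu> + i), 1:] ^ \<beta> i) \<in> poly_rel G"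
        unfolding E_def
      proof (intro subring_rel_prod[OF P] subring_rel_power[OF P] poly_rel_pCons poly_rel_0[OF G])
        show "(- of_nat (\<nu> + i), - of_nat (\<nu> + i)) \<in> G" for i
          unfolding G_def by (auto simp: hom_distribs)
        show "(1, 1) \<in> G" using G by (rule subring_rel_one)
      qed
      then show "coeff (map_poly emb (smult (of_nat d) E)) i
          = coeff (smult (of_nat d) (\<Prod>i=1..k. [:- of_nat (\<nu> + i), 1:] ^ \<beta> i)) i" for i
        unfolding poly_rel_def G_def by (auto simp: coeff_map_poly hom_distribs)
    qed
    finally have "emb (s r) \<noteq> of_nat (\<nu> + i)"
      using \<nu>[of "\<lambda>r. emb (s r)" r i] r i s0 by (simp add: hom_distribs)
    then show ?thesis by (metis hom_of_nat)
  qed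
  have "inj_on s {..<N}"
  proof (rule inj_onI)
    fix p q assume pq: "p \<in> {..<N}" "q \<in> {..<N}" "s p = s q"
    \<comment> \<open>A repeated zero is a root of \<open>wderiv\<close>, hence one of the chosen
      critical points, which \<open>ne\<close> excludes.\<close>
    show "p = q"
    proof (rule ccontr)
      assume "p \<noteq> q"
      have "poly (wderiv (\<lambda>r. of_nat (w r)) s N) (s p) = 0"
        unfolding poly_wderiv
      proof (rule sum.neutral, rule ballI)
        fix r assume "r \<in> {..<N}"
        have "(\<Prod>u\<in>{..<N} - {r}. s p - s u) = 0"
          using pq \<open>p \<noteq> q\<close> by (intro prod_zero bexI[of _ "if r = p then q else p"]) auto
        then show "of_nat (w r) * (\<Prod>u\<in>{..<N} - {r}. s p - s u) = 0" by simp
      qed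
      moreover have "d > 0" unfolding d_def using w N by (intro sum_pos) auto
      ultimately have "poly E (s p) = 0" unfolding s by simp
      then have "(\<Prod>i=1..k. (s p - of_nat (\<nu> + i)) ^ \<beta> i) = 0"
        unfolding E_def by (simp add: poly_prod algebra_simps)
      then obtain i where "i \<in> {1..k}" "s p - of_nat (\<nu> + i) = 0"
        by (auto simp: prod_zero_iff simp del: of_nat_add right_minus_eq)
      then show False using ne[of p i] pq(1) by auto
    qed
  qed
  moreover have "inj_on (\<lambda>i. of_nat (\<nu> + i) :: 'a) {1..k}" by (auto simp: inj_on_def)
  moreover have "s ` {..<N} \<inter> (\<lambda>i. of_nat (\<nu> + i)) ` {1..k} = {}" using ne by blast
  ultimately show ?thesis using s that[of s "\<lambda>i. of_nat (\<nu> + i)"] unfolding E_def d_def by blast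
qed

section \<open>Bordered matrices\<close>

lemma kernel_dim_le_1I:
  fixes C :: "'a::field mat"
  assumes C: "C \<in> carrier_mat n n" and y: "y \<in> mat_kernel C"
    and mult: "\<And>x. x \<in> mat_kernel C \<Longrightarrow> \<exists>c. x = c \<cdot>\<^sub>v y"
  shows "kernel_dim C \<le> 1"
proof -
  interpret K: kernel n n C by unfold_locales (rule C)
  have yC: "y \<in> carrier_vec n" using y mat_kernelD[OF C] by blast
  have "K.span {y} = mat_kernel C"
  proof
    show "K.span {y} \<subseteq> mat_kernel C" using K.Ker.span_is_subset2[of "{y}"] y by auto
    show "mat_kernel C \<subseteq> K.span {y}"
    proof
      fix x assume "x \<in> mat_kernel C"
      then obtain c where c: "x = c \<cdot>\<^sub>v y" using mult by blast
      have "K.lincomb (\<lambda>_. c) {y} = x"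
        unfolding c K.lincomb_same[of "{y}", OF subsetI[of "{y}"], simplified, OF y]
        using yC by (intro eq_vecI) (auto simp: K.NC.lincomb_def)
      then show "x \<in> K.span {y}"
        unfolding K.Ker.span_def using y by (auto intro!: exI[of _ "\<lambda>_. c"] exI[of _ "{y}"])
    qed
  qed
  then have "K.dim \<le> 1" using y by (intro K.Ker.dim_le1I[of y]) simp_all
  then show ?thesis by simp
qed

text \<open>Gauss-Jordan elimination preserves the kernel, and the explicit basis read off from the
  reduced matrix has exactly one element.\<close>

lemma kernel_dim_1D:
  fixes C :: "'a::field mat"
  assumes C: "C \<in> carrier_mat n n" and dim: "kernel_dim C = 1"
  obtains y where "y \<in> carrier_vec n" "y \<noteq> 0\<^sub>v n" "C *\<^sub>v y = 0\<^sub>v n"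
    "\<And>x. x \<in> carrier_vec n \<Longrightarrow> C *\<^sub>v x = 0\<^sub>v n \<Longrightarrow> \<exists>c. x = c \<cdot>\<^sub>v y"
proof -
  define G where "G = gauss_jordan_single C"
  note gj = gauss_jordan_single[OF C G_def[symmetric]]
  interpret K: kernel n n G by unfold_locales (rule gj(2))
  let ?B = "set (find_base_vectors G)"
  note fb = find_base_vectors[OF gj(3) gj(2)]
  have "kernel_dim C = n - length (pivot_positions G)"
    unfolding kernel_dim_code G_def using C by simp
  then have "card ?B = 1" unfolding fb(4) using dim fb(5) by simp
  then obtain y where y: "?B = {y}" by (rule card_1_singletonE)
  have ker: "x \<in> mat_kernel G \<longleftrightarrow> x \<in> carrier_vec n \<and> C *\<^sub>v x = 0\<^sub>v n" for x
    using gj(1)[of x] mat_kernel[OF gj(2)] by auto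
  have yG: "y \<in> mat_kernel G" using fb(1) y by auto
  have span: "mat_kernel G = K.span {y}" using fb(3) unfolding y K.Ker.basis_def by auto
  show ?thesis
  proof (rule that[of y])
    show "y \<in> carrier_vec n" "C *\<^sub>v y = 0\<^sub>v n" using yG ker by auto
    show "y \<noteq> 0\<^sub>v n" using fb(2) y by auto
    fix x assume "x \<in> carrier_vec n" "C *\<^sub>v x = 0\<^sub>v n"
    then have x: "x \<in> mat_kernel G" using ker by blast
    then have "x \<in> K.span {y}" using span by simp
    then obtain a where a: "K.lincomb a {y} = x"
      using K.Ker.finite_in_span[of "{y}" x] yG by auto
    have "x = a y \<cdot>\<^sub>v y"
    proof (rule eq_vecI)
      fix i assume "i < dim_vec (a y \<cdot>\<^sub>v y)"
      then have i: "i < n" using yG ker by auto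
      show "x $ i = (a y \<cdot>\<^sub>v y) $ i"
        using K.lincomb_index[OF i, of "{y}" a] yG i ker unfolding a by auto
    qed (use x yG ker in auto)
    then show "\<exists>c. x = c \<cdot>\<^sub>v y" by blast
  qed
qed

text \<open>If the intersection were trivial, the linear form given by \<open>v\<close> would be
  injective on the kernel and bound its dimension by one.\<close>

lemma kernel_meets_hyperplane:
  fixes C :: "'a::field mat"
  assumes C: "C \<in> carrier_mat n n" and dim: "kernel_dim C > 1" and v: "v \<in> carrier_vec n"
  shows "\<exists>x. x \<in> carrier_vec n \<and> x \<noteq> 0\<^sub>v n \<and> C *\<^sub>v x = 0\<^sub>v n \<and> v \<bullet> x = 0"
proof (rule ccontr)
  assume "\<not> ?thesis"
  then have inj: "x = 0\<^sub>v n" if "x \<in> carrier_vec n" "C *\<^sub>v x = 0\<^sub>v n" "v \<bullet> x = 0" for x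
    using that by blast
  have ker: "x \<in> mat_kernel C \<longleftrightarrow> x \<in> carrier_vec n \<and> C *\<^sub>v x = 0\<^sub>v n" for x
    using mat_kernel[OF C] by auto
  show False
  proof (cases "\<exists>y\<in>mat_kernel C. v \<bullet> y \<noteq> 0")
    case True
    then obtain y where y: "y \<in> carrier_vec n" "C *\<^sub>v y = 0\<^sub>v n" "v \<bullet> y \<noteq> 0" using ker by auto
    have "kernel_dim C \<le> 1"
    proof (rule kernel_dim_le_1I[OF C])
      show "y \<in> mat_kernel C" using y ker by blast
      fix x assume "x \<in> mat_kernel C"
      then have x: "x \<in> carrier_vec n" "C *\<^sub>v x = 0\<^sub>v n" using ker by auto
      define c where "c = (v \<bullet> x) / (v \<bullet> y)"
      have "x + (- c) \<cdot>\<^sub>v y = 0\<^sub>v n"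
      proof (rule inj)
        show "x + (- c) \<cdot>\<^sub>v y \<in> carrier_vec n" using x y by simp
        have "C *\<^sub>v (x + (- c) \<cdot>\<^sub>v y) = C *\<^sub>v x + (- c) \<cdot>\<^sub>v (C *\<^sub>v y)"
          using C x(1) y(1) by (simp add: mult_add_distrib_mat_vec mult_mat_vec)
        also have "\<dots> = 0\<^sub>v n" unfolding x(2) y(2) by (intro eq_vecI) auto
        finally show "C *\<^sub>v (x + (- c) \<cdot>\<^sub>v y) = 0\<^sub>v n" .
        have "v \<bullet> (x + (- c) \<cdot>\<^sub>v y) = v \<bullet> x + (- c) * (v \<bullet> y)"
          using v x(1) y(1) by (simp add: scalar_prod_add_distrib[of _ n])
        then show "v \<bullet> (x + (- c) \<cdot>\<^sub>v y) = 0" using y(3) by (simp add: c_def)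
      qed
      then have "x $ i + (- c) * y $ i = 0" if "i < n" for i
        using that x(1) y(1) by (metis (no_types, lifting) carrier_vecD index_add_vec(1) index_smult_vec(1) index_smult_vec(2) index_zero_vec(1))
      then have "x = c \<cdot>\<^sub>v y" using x(1) y(1) by (intro eq_vecI) (auto simp: algebra_simps)
      then show "\<exists>c. x = c \<cdot>\<^sub>v y" by blast
    qed
    with dim show False by simp
  next
    case False
    have zero: "0\<^sub>v n \<in> mat_kernel C"
      by (rule mat_kernelI[OF C]) (use C in \<open>auto intro!: eq_vecI simp: scalar_prod_def\<close>)
    have "kernel_dim C \<le> 1"
    proof (rule kernel_dim_le_1I[OF C zero])
      fix x assume "x \<in> mat_kernel C"
      then have "x = 0\<^sub>v n" using False ker inj by blast
      then show "\<exists>c. x = c \<cdot>\<^sub>v 0\<^sub>v n" by (intro exI[of _ 0]) auto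
    qed
    with dim show False by simp
  qed
qed

section \<open>Characteristic polynomials of bordered matrices\<close>

definition bordered :: "'a::zero mat \<Rightarrow> 'a vec \<Rightarrow> 'a vec \<Rightarrow> 'a \<Rightarrow> 'a mat" where
  "bordered B u v b = four_block_mat B (transpose_mat (mat_of_row u)) (mat_of_row v) (mat 1 1 (\<lambda>_. b))"

lemma bordered_carrier:
  "B \<in> carrier_mat n n \<Longrightarrow> bordered B u v b \<in> carrier_mat (n + 1) (n + 1)"
  unfolding bordered_def by auto

lemma bordered_mult_vec:
  fixes B :: "'a::comm_ring_1 mat"
  assumes B: "B \<in> carrier_mat n n" and u: "u \<in> carrier_vec n" and v: "v \<in> carrier_vec n"
    and x: "x \<in> carrier_vec n"
  shows "bordered B u v b *\<^sub>v (x @\<^sub>v vec 1 (\<lambda>_. y))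
    = (B *\<^sub>v x + y \<cdot>\<^sub>v u) @\<^sub>v vec 1 (\<lambda>_. v \<bullet> x + b * y)"
proof -
  have "transpose_mat (mat_of_row u) *\<^sub>v vec 1 (\<lambda>_. y) = y \<cdot>\<^sub>v u"
    using u by (intro eq_vecI) (auto simp: mat_of_row_def scalar_prod_def mult.commute)
  moreover have "mat_of_row v *\<^sub>v x + mat 1 1 (\<lambda>_. b) *\<^sub>v vec 1 (\<lambda>_. y) = vec 1 (\<lambda>_. v \<bullet> x + b * y)"
    using v x by (intro eq_vecI) (auto simp: mat_of_row_def scalar_prod_def)
  moreover have "bordered B u v b *\<^sub>v (x @\<^sub>v vec 1 (\<lambda>_. y))
      = (B *\<^sub>v x + transpose_mat (mat_of_row u) *\<^sub>v vec 1 (\<lambda>_. y))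
        @\<^sub>v (mat_of_row v *\<^sub>v x + mat 1 1 (\<lambda>_. b) *\<^sub>v vec 1 (\<lambda>_. y))"
    unfolding bordered_def
    by (rule four_block_mat_mult_vec) (use B u v x in \<open>auto simp: mat_of_row_def\<close>)
  ultimately show ?thesis by simp
qed

lemma smult_one_minus_kernel:
  fixes B :: "'a::comm_ring_1 mat"
  assumes "B \<in> carrier_mat n n" "x \<in> carrier_vec n"
  shows "(B - e \<cdot>\<^sub>m 1\<^sub>m n) *\<^sub>v x = B *\<^sub>v x - e \<cdot>\<^sub>v x"
proof -
  have "(e \<cdot>\<^sub>m 1\<^sub>m n) *\<^sub>v x = e \<cdot>\<^sub>v x"
    using assms by (intro eq_vecI) auto
  then show ?thesis using assms by (simp add: minus_mult_distrib_mat_vec[of _ n n])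
qed

text \<open>A vector of the kernel orthogonal to \<open>v\<close>, extended by \<open>0\<close>, is
  an eigenvector of the bordered matrix for every \<open>u\<close> and \<open>b\<close>.\<close>

lemma char_poly_bordered_root:
  fixes B :: "'a::field mat"
  assumes B: "B \<in> carrier_mat n n" and u: "u \<in> carrier_vec n" and v: "v \<in> carrier_vec n"
    and dim: "kernel_dim (B - e \<cdot>\<^sub>m 1\<^sub>m n) > 1"
  shows "poly (char_poly (bordered B u v b)) e = 0"
proof -
  have C: "B - e \<cdot>\<^sub>m 1\<^sub>m n \<in> carrier_mat n n"
    by (intro minus_carrier_mat smult_carrier_mat one_carrier_mat)
  obtain x where x: "x \<in> carrier_vec n" "x \<noteq> 0\<^sub>v n" "(B - e \<cdot>\<^sub>m 1\<^sub>m n) *\<^sub>v x = 0\<^sub>v n" "v \<bullet> x = 0"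
    using kernel_meets_hyperplane[OF C dim v] by blast
  have "B *\<^sub>v x - e \<cdot>\<^sub>v x = 0\<^sub>v n" using x(3) smult_one_minus_kernel[OF B x(1)] by simp
  then have Bx: "B *\<^sub>v x = e \<cdot>\<^sub>v x"
    using B x(1) by (intro eq_vecI) (auto dest: arg_cong[where f = "\<lambda>w. w $ _"] simp: vec_eq_iff)
  define z where "z = x @\<^sub>v vec 1 (\<lambda>_. 0 :: 'a)"
  have "bordered B u v b *\<^sub>v z = (B *\<^sub>v x + 0 \<cdot>\<^sub>v u) @\<^sub>v vec 1 (\<lambda>_. v \<bullet> x + b * 0)"
    unfolding z_def by (rule bordered_mult_vec[OF B u v x(1)])
  also have "\<dots> = e \<cdot>\<^sub>v z"
    unfolding Bx x(4) z_def using u x(1) by (intro eq_vecI) auto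
  finally have "bordered B u v b *\<^sub>v z = e \<cdot>\<^sub>v z" .
  moreover have "z \<noteq> 0\<^sub>v (n + 1)"
  proof
    assume "z = 0\<^sub>v (n + 1)"
    then have "z $ i = 0" if "i < n" for i using that by simp
    then have "x = 0\<^sub>v n" using x(1) unfolding z_def by (intro eq_vecI) auto
    with x(2) show False by simp
  qed
  moreover have "z \<in> carrier_vec (n + 1)" unfolding z_def using x(1) by (intro carrier_vecI) auto
  ultimately have "eigenvalue (bordered B u v b) e"
    unfolding eigenvalue_def eigenvector_def using bordered_carrier[OF B, of u v b] by auto
  then show ?thesis using eigenvalue_root_char_poly[OF bordered_carrier[OF B]] by blast
qed

text \<open>\<open>R\<close> is the row \<open>v\<close> times the adjugate of the characteristic
  matrix of \<open>B\<close>. The first property is the adjugate identity, read columnwise; the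
  second is a Schur complement without denominators.\<close>

lemma char_poly_bordered:
  fixes B :: "'a::field mat"
  assumes B: "B \<in> carrier_mat n n" and v: "v \<in> carrier_vec n"
  obtains R :: "nat \<Rightarrow> 'a poly" where
    "\<And>j. j < n \<Longrightarrow> [:0, 1:] * R j = (\<Sum>i<n. R i * [:B $$ (i, j):]) + char_poly B * [:v $ j:]"
    "\<And>u b. u \<in> carrier_vec n \<Longrightarrow> char_poly (bordered B u v b)
        = [:- b, 1:] * char_poly B - (\<Sum>j<n. R j * [:u $ j:])"
proof -
  define p where "p = char_poly B"
  define M where "M = char_poly_matrix B"
  define V where "V = mat 1 n (\<lambda>(i, j). [:v $ j:])"
  define T where "T = V * adj_mat M"
  define R where "R j = T $$ (0, j)" for j
  have M: "M \<in> carrier_mat n n" unfolding M_def using B by simp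
  have Mij: "M $$ (i, j) = (if i = j then [:0, 1:] else 0) - [:B $$ (i, j):]" if "i < n" "j < n" for i j
    using that B unfolding M_def char_poly_matrix_def by auto
  have V: "V \<in> carrier_mat 1 n" unfolding V_def by simp
  have T: "T \<in> carrier_mat 1 n" unfolding T_def using V adj_mat(1)[OF M] by simp
  have p0: "p \<noteq> 0" using degree_monic_char_poly[OF B] unfolding p_def by auto
  have "T * M = V * (adj_mat M * M)" unfolding T_def using V adj_mat(1)[OF M] M by (rule assoc_mult_mat)
  also have "\<dots> = p \<cdot>\<^sub>m V"
    unfolding adj_mat(3)[OF M] M_def[symmetric] using V
    by (simp add: p_def char_poly_def M_def[symmetric] mult_smult_distrib[of _ 1 n _ n])
  finally have TM: "T * M = p \<cdot>\<^sub>m V" .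
  have TMj: "(\<Sum>i<n. R i * M $$ (i, j)) = p * [:v $ j:]" if j: "j < n" for j
  proof -
    have "(T * M) $$ (0, j) = (\<Sum>i<n. R i * M $$ (i, j))"
      using T M j by (auto simp: scalar_prod_def R_def atLeast0LessThan intro!: sum.cong)
    moreover have "(p \<cdot>\<^sub>m V) $$ (0, j) = p * [:v $ j:]" using j V by (simp add: V_def)
    ultimately show ?thesis using TM by simp
  qed
  show ?thesis
  proof (rule that[of R])
    fix j assume j: "j < n"
    have "(\<Sum>i<n. R i * M $$ (i, j)) = (\<Sum>i<n. (if i = j then [:0, 1:] * R j else 0) - R i * [:B $$ (i, j):])"
    proof (intro sum.cong refl)
      fix i assume "i \<in> {..<n}"
      then have i: "i < n" by simp
      show "R i * M $$ (i, j) = (if i = j then [:0, 1:] * R j else 0) - R i * [:B $$ (i, j):]"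
        unfolding Mij[OF i j] right_diff_distrib by simp
    qed
    also have "\<dots> = [:0, 1:] * R j - (\<Sum>i<n. R i * [:B $$ (i, j):])"
      using j by (simp add: sum_subtractf)
    finally show "[:0, 1:] * R j = (\<Sum>i<n. R i * [:B $$ (i, j):]) + char_poly B * [:v $ j:]"
      using TMj[OF j] unfolding p_def by (simp add: algebra_simps)
  next
    fix u :: "'a vec" and b :: 'a assume u: "u \<in> carrier_vec n"
    define U where "U = mat n 1 (\<lambda>(i, j). [:- u $ i:])"
    define c where "c = mat 1 1 (\<lambda>_. [:- b, 1:])"
    define P where "P = mat 1 1 (\<lambda>_. p)"
    have car: "U \<in> carrier_mat n 1" "c \<in> carrier_mat 1 1" "P \<in> carrier_mat 1 1" "- V \<in> carrier_mat 1 n"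
      unfolding U_def c_def P_def using V by auto
    have chi: "char_poly_matrix (bordered B u v b) = four_block_mat M U (- V) c"
    proof (rule eq_matI)
      show "dim_row (char_poly_matrix (bordered B u v b)) = dim_row (four_block_mat M U (- V) c)"
        "dim_col (char_poly_matrix (bordered B u v b)) = dim_col (four_block_mat M U (- V) c)"
        using bordered_carrier[OF B, of u v b] M car by (auto simp: char_poly_matrix_def)
      fix i j assume "i < dim_row (four_block_mat M U (- V) c)" "j < dim_col (four_block_mat M U (- V) c)"
      then have "i < n + 1" "j < n + 1" using M car by auto
      then show "char_poly_matrix (bordered B u v b) $$ (i, j) = four_block_mat M U (- V) c $$ (i, j)"
        using B M V u v car bordered_carrier[OF B, of u v b]
        unfolding char_poly_matrix_def bordered_def
        by (auto simp: M_def char_poly_matrix_def U_def V_def c_def mat_of_row_def less_Suc_eq)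
    qed
    \<comment> \<open>Multiplication by \<open>L\<close> clears the lower left block. As
      \<open>det L\<close> is the nonzero polynomial \<open>p\<close>, it can be cancelled
      afterwards.\<close>
    define L where "L = four_block_mat (1\<^sub>m n) (0\<^sub>m n 1) T P"
    have "L * four_block_mat M U (- V) c
        = four_block_mat (1\<^sub>m n * M + 0\<^sub>m n 1 * - V) (1\<^sub>m n * U + 0\<^sub>m n 1 * c) (T * M + P * - V) (T * U + P * c)"
      unfolding L_def using T M car by (intro mult_four_block_mat) auto
    also have "1\<^sub>m n * M + 0\<^sub>m n 1 * - V = M"
      unfolding left_mult_zero_mat[OF car(4)] using M by simp
    also have "1\<^sub>m n * U + 0\<^sub>m n 1 * c = U" using car by simp
    also have "T * M + P * - V = 0\<^sub>m 1 n"
      unfolding TM using V by (intro eq_matI) (auto simp: P_def scalar_prod_def)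
    also have "T * U + P * c = mat 1 1 (\<lambda>_. p * [:- b, 1:] - (\<Sum>j<n. R j * [:u $ j:]))"
      using T by (intro eq_matI)
        (auto simp: P_def c_def U_def R_def scalar_prod_def atLeast0LessThan sum_negf[symmetric] intro!: sum.cong)
    finally have "det L * det (four_block_mat M U (- V) c)
        = det (four_block_mat M U (0\<^sub>m 1 n) (mat 1 1 (\<lambda>_. p * [:- b, 1:] - (\<Sum>j<n. R j * [:u $ j:]))))"
      by (subst det_mult[symmetric, of _ "n + 1"]) (use T M car in \<open>auto simp: L_def\<close>)
    also have "\<dots> = p * (p * [:- b, 1:] - (\<Sum>j<n. R j * [:u $ j:]))"
      by (subst det_four_block_mat_lower_left_zero[of _ n _ 1])
        (use M car in \<open>auto simp: p_def char_poly_def M_def det_single\<close>)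
    also have "det L = p"
      unfolding L_def by (subst det_four_block_mat_upper_right_zero[of _ n _ 1])
        (use T car in \<open>auto simp: P_def det_single\<close>)
    finally have "p * char_poly (bordered B u v b) = p * (p * [:- b, 1:] - (\<Sum>j<n. R j * [:u $ j:]))"
      unfolding char_poly_def chi .
    then have "char_poly (bordered B u v b) = p * [:- b, 1:] - (\<Sum>j<n. R j * [:u $ j:])"
      using p0 by simp
    then show "char_poly (bordered B u v b) = [:- b, 1:] * char_poly B - (\<Sum>j<n. R j * [:u $ j:])"
      unfolding p_def by (simp add: mult.commute)
  qed
qed

section \<open>Realising prescribed characteristic polynomials\<close>

text \<open>On the moment curve \<open>(1, t, t^2, ...)\<close> the scalar products are nonzero
  polynomials in \<open>t\<close>, which have only finitely many roots in the infinite
  field.\<close>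

lemma exists_vec_nonorthogonal:
  fixes y :: "'b \<Rightarrow> 'a::field_char_0 vec"
  assumes I: "finite I" and y: "\<And>i. i \<in> I \<Longrightarrow> y i \<in> carrier_vec n \<and> y i \<noteq> 0\<^sub>v n"
  obtains v where "v \<in> carrier_vec n" "\<And>i. i \<in> I \<Longrightarrow> v \<bullet> y i \<noteq> 0"
proof -
  define q where "q i = (\<Sum>j<n. monom (y i $ j) j)" for i
  have coeff: "coeff (q i) j = y i $ j" if "j < n" for i j
    using that unfolding q_def coeff_sum coeff_monom by simp
  have "q i \<noteq> 0" if i: "i \<in> I" for i
  proof
    assume q0: "q i = 0"
    have "y i $ j = 0" if "j < n" for j
      unfolding coeff[OF that, symmetric] q0 by (rule coeff_0)
    then have "y i = 0\<^sub>v n" using conjunct1[OF y[OF i]] by (intro eq_vecI) simp_all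
    with conjunct2[OF y[OF i]] show False by (rule notE)
  qed
  then have "prod q I \<noteq> 0" using I by (simp add: prod_zero_iff)
  then have fin: "finite {t. poly (prod q I) t = 0}" by (rule poly_roots_finite)
  have "\<exists>t. poly (prod q I) t \<noteq> 0"
  proof (rule ccontr)
    assume "\<not> ?thesis"
    then have "{t. poly (prod q I) t = 0} = UNIV" by simp
    with fin show False using infinite_UNIV_char_0[where ?'a = 'a] by simp
  qed
  then obtain t where t: "poly (prod q I) t \<noteq> 0" ..
  show ?thesis
  proof (rule that[of "vec n (\<lambda>j. t ^ j)"])
    fix i assume i: "i \<in> I"
    have "vec n (\<lambda>j. t ^ j) \<bullet> y i = (\<Sum>j<n. t ^ j * y i $ j)"
      using y[OF i] by (auto simp: scalar_prod_def atLeast0LessThan)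
    also have "\<dots> = poly (q i) t"
      unfolding q_def poly_sum poly_monom by (intro sum.cong refl) (rule mult.commute)
    also have "\<dots> \<noteq> 0"
    proof
      assume "poly (q i) t = 0"
      then have "poly (prod q I) t = 0" unfolding poly_prod using I i by (intro prod_zero) auto
      with t show False ..
    qed
    finally show "vec n (\<lambda>j. t ^ j) \<bullet> y i \<noteq> 0" .
  qed simp
qed

text \<open>Since \<open>g\<close> does not vanish at \<open>t\<close>, every linear factor must
  divide the cofactor and can be removed.\<close>

lemma dvd_cancel_linear_power:
  fixes g q :: "'a::field poly"
  assumes "g dvd q * [:- t, 1:] ^ k" and "poly g t \<noteq> 0"
  shows "g dvd q"
  using assms(1)
proof (induction k)
  case (Suc k)
  then obtain h where h: "q * [:- t, 1:] ^ Suc k = g * h" by (elim dvdE)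
  have "poly (g * h) t = 0" unfolding h[symmetric] by simp
  then have "poly h t = 0" using assms(2) by simp
  then obtain h' where h': "h = [:- t, 1:] * h'" unfolding poly_eq_0_iff_dvd by (elim dvdE)
  have "[:- t, 1:] * (q * [:- t, 1:] ^ k) = [:- t, 1:] * (g * h')"
    using h unfolding h' by (simp only: power_Suc mult_ac)
  then have "q * [:- t, 1:] ^ k = g * h'" by (subst (asm) mult_cancel_left) auto
  then show ?case using Suc.IH by simp
qed simp

text \<open>With \<open>u\<close> outside the image of \<open>B - e I\<close>, an eigenvector for
  \<open>e\<close> must end in \<open>0\<close>. Its upper part is then a multiple of
  \<open>y\<close> orthogonal to \<open>v\<close>, hence zero.\<close>

lemma bordered_avoids_eigenvalue:
  fixes B :: "'a::field mat"
  assumes B: "B \<in> carrier_mat n n" and v: "v \<in> carrier_vec n"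
    and y: "y \<in> carrier_vec n" "y \<noteq> 0\<^sub>v n" "(B - e \<cdot>\<^sub>m 1\<^sub>m n) *\<^sub>v y = 0\<^sub>v n" "v \<bullet> y \<noteq> 0"
    and ker: "\<And>x. x \<in> carrier_vec n \<Longrightarrow> (B - e \<cdot>\<^sub>m 1\<^sub>m n) *\<^sub>v x = 0\<^sub>v n \<Longrightarrow> \<exists>c. x = c \<cdot>\<^sub>v y"
  obtains u where "u \<in> carrier_vec n" "poly (char_poly (bordered B u v 0)) e \<noteq> 0"
proof -
  define C where "C = B - e \<cdot>\<^sub>m 1\<^sub>m n"
  have C: "C \<in> carrier_mat n n" unfolding C_def
    by (intro minus_carrier_mat smult_carrier_mat one_carrier_mat)
  have "det C = 0" using det_0_iff_vec_prod_zero_field[OF C] y unfolding C_def by blast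
  then have "det (transpose_mat C) = 0" using det_transpose[OF C] by simp
  then obtain w where w: "w \<in> carrier_vec n" "w \<noteq> 0\<^sub>v n" "transpose_mat C *\<^sub>v w = 0\<^sub>v n"
    using det_0_iff_vec_prod_zero_field[of "transpose_mat C" n] C by auto
  have wC: "w \<bullet> (C *\<^sub>v x) = 0" if x: "x \<in> carrier_vec n" for x
  proof -
    have "w \<bullet> (C *\<^sub>v x) = (transpose_mat C *\<^sub>v w) \<bullet> x"
      using transpose_vec_mult_scalar[OF C x w(1)] by (rule sym)
    then show ?thesis using x unfolding w(3) by simp
  qed
  obtain i where i: "i < n" "w $ i \<noteq> 0"
  proof (rule ccontr)
    assume "\<not> thesis"
    then have "w = 0\<^sub>v n" using w(1) that by (intro eq_vecI) auto
    with w(2) show False by simp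
  qed
  \<comment> \<open>The left null vector \<open>w\<close> annihilates the image of \<open>C\<close>
    but not this unit vector.\<close>
  define u :: "'a vec" where "u = unit_vec n i"
  have u: "u \<in> carrier_vec n" unfolding u_def by simp
  have wu: "w \<bullet> u \<noteq> 0" unfolding u_def using w(1) i by simp
  have "\<not> eigenvalue (bordered B u v 0) e"
  proof
    assume "eigenvalue (bordered B u v 0) e"
    then obtain z where z: "z \<in> carrier_vec (n + 1)" "z \<noteq> 0\<^sub>v (n + 1)" "bordered B u v 0 *\<^sub>v z = e \<cdot>\<^sub>v z"
      unfolding eigenvalue_def eigenvector_def using bordered_carrier[OF B, of u v 0] by auto
    define x where "x = vec n (\<lambda>j. z $ j)"
    define t where "t = z $ n"
    have x: "x \<in> carrier_vec n" unfolding x_def by simp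
    have zx: "z = x @\<^sub>v vec 1 (\<lambda>_. t)"
      using z(1) unfolding x_def t_def by (intro eq_vecI) (auto simp: less_Suc_eq)
    have eq: "(B *\<^sub>v x + t \<cdot>\<^sub>v u) @\<^sub>v vec 1 (\<lambda>_. v \<bullet> x + 0 * t) = e \<cdot>\<^sub>v (x @\<^sub>v vec 1 (\<lambda>_. t))"
      using z(3) unfolding zx bordered_mult_vec[OF B u v x] .
    have top: "(B *\<^sub>v x) $ j + t * u $ j = e * x $ j" if j: "j < n" for j
    proof -
      have "((B *\<^sub>v x + t \<cdot>\<^sub>v u) @\<^sub>v vec 1 (\<lambda>_. v \<bullet> x + 0 * t)) $ j = (e \<cdot>\<^sub>v (x @\<^sub>v vec 1 (\<lambda>_. t))) $ j"
        unfolding eq ..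
      then show ?thesis using j B u x by simp
    qed
    have bot: "v \<bullet> x = e * t"
    proof -
      have "((B *\<^sub>v x + t \<cdot>\<^sub>v u) @\<^sub>v vec 1 (\<lambda>_. v \<bullet> x + 0 * t)) $ n = (e \<cdot>\<^sub>v (x @\<^sub>v vec 1 (\<lambda>_. t))) $ n"
        unfolding eq ..
      then show ?thesis using B u x by simp
    qed
    have Cx: "C *\<^sub>v x = (- t) \<cdot>\<^sub>v u"
    proof (rule eq_vecI)
      fix j assume "j < dim_vec ((- t) \<cdot>\<^sub>v u)"
      then have j: "j < n" using u by simp
      show "(C *\<^sub>v x) $ j = ((- t) \<cdot>\<^sub>v u) $ j"
        using top[OF j] j B x u unfolding C_def smult_one_minus_kernel[OF B x] by (simp add: algebra_simps)
    qed (use C u in auto)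
    have "(- t) * (w \<bullet> u) = 0" using wC[OF x] w(1) u unfolding Cx by simp
    then have t: "t = 0" using wu by simp
    have "C *\<^sub>v x = 0\<^sub>v n" unfolding Cx t using u by (intro eq_vecI) auto
    then obtain c where c: "x = c \<cdot>\<^sub>v y" using ker[OF x] unfolding C_def by blast
    have "c * (v \<bullet> y) = 0" using bot v y(1) unfolding c t by simp
    then have "c = 0" using y(4) by simp
    then have "z = 0\<^sub>v (n + 1)" unfolding zx c t using y(1) by (intro eq_vecI) auto
    with z(2) show False by simp
  qed
  then have "poly (char_poly (bordered B u v 0)) e \<noteq> 0"
    using eigenvalue_root_char_poly[OF bordered_carrier[OF B]] by blast
  then show ?thesis using that u by blast
qed

text \<open>A single \<open>v\<close> is chosen that is not orthogonal to any of the eigenvectors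
  for the \<open>mu i\<close>. The ideal \<open>J\<close> then contains every multiple of
  \<open>pl\<close>, in particular \<open>P\<close>, and comparing degrees identifies the multiple
  of \<open>p\<close> as \<open>[:- b, 1:]\<close>.\<close>

theorem bordered_char_poly_realizable:
  fixes B :: "'a::field_char_0 mat"
  assumes B: "B \<in> carrier_mat n n" and I: "finite I"
    and p: "char_poly B = pl * (\<Prod>i\<in>I. [:- mu i, 1:] ^ \<beta> i)"
    and ker: "\<And>i. i \<in> I \<Longrightarrow> kernel_dim (B - mu i \<cdot>\<^sub>m 1\<^sub>m n) = 1"
    and P: "degree P = n + 1" "lead_coeff P = 1" and dvd: "pl dvd P"
  obtains u v b where "u \<in> carrier_vec n" "v \<in> carrier_vec n" "char_poly (bordered B u v b) = P"
proof -
  have "\<exists>y. y \<in> carrier_vec n \<and> y \<noteq> 0\<^sub>v n \<and> (B - mu i \<cdot>\<^sub>m 1\<^sub>m n) *\<^sub>v y = 0\<^sub>v n \<and>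
      (\<forall>x. x \<in> carrier_vec n \<longrightarrow> (B - mu i \<cdot>\<^sub>m 1\<^sub>m n) *\<^sub>v x = 0\<^sub>v n \<longrightarrow> (\<exists>c. x = c \<cdot>\<^sub>v y))" if i: "i \<in> I" for i
  proof -
    have C: "B - mu i \<cdot>\<^sub>m 1\<^sub>m n \<in> carrier_mat n n"
      by (intro minus_carrier_mat smult_carrier_mat one_carrier_mat)
    show ?thesis using kernel_dim_1D[OF C ker[OF i]] by metis
  qed
  then obtain y where y: "\<And>i. i \<in> I \<Longrightarrow> y i \<in> carrier_vec n" "\<And>i. i \<in> I \<Longrightarrow> y i \<noteq> 0\<^sub>v n"
    "\<And>i. i \<in> I \<Longrightarrow> (B - mu i \<cdot>\<^sub>m 1\<^sub>m n) *\<^sub>v y i = 0\<^sub>v n"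
    "\<And>i x. i \<in> I \<Longrightarrow> x \<in> carrier_vec n \<Longrightarrow> (B - mu i \<cdot>\<^sub>m 1\<^sub>m n) *\<^sub>v x = 0\<^sub>v n \<Longrightarrow> \<exists>c. x = c \<cdot>\<^sub>v y i"
    by metis
  obtain v where v: "v \<in> carrier_vec n" and vy: "\<And>i. i \<in> I \<Longrightarrow> v \<bullet> y i \<noteq> 0"
    using exists_vec_nonorthogonal[OF I, of y n] y(1,2) by blast
  define p where "p = char_poly B"
  obtain R where R: "\<And>j. j < n \<Longrightarrow> [:0, 1:] * R j = (\<Sum>i<n. R i * [:B $$ (i, j):]) + p * [:v $ j:]"
    and chi: "\<And>u b. u \<in> carrier_vec n \<Longrightarrow> char_poly (bordered B u v b)
        = [:- b, 1:] * p - (\<Sum>j<n. R j * [:u $ j:])"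
    using char_poly_bordered[OF B v] unfolding p_def by blast
  have p_deg: "degree p = n" "lead_coeff p = 1" using degree_monic_char_poly[OF B] unfolding p_def by auto
  then have p0: "p \<noteq> 0" by auto
  text \<open>Modulo \<open>p\<close>, the polynomials \<open>\<Sum> R j * u j\<close> with constant \<open>u\<close> form an ideal.\<close>
  define J where "J = {(\<Sum>j<n. R j * [:f j:]) + p * q | f q. True}"
  have JI: "(\<Sum>j<n. R j * [:f j:]) + p * q \<in> J" for f q unfolding J_def by blast
  have Jdiff: "x - z \<in> J" if xz: "x \<in> J" "z \<in> J" for x z
  proof -
    obtain f q f' q' where "x = (\<Sum>j<n. R j * [:f j:]) + p * q" "z = (\<Sum>j<n. R j * [:f' j:]) + p * q'"
      using xz unfolding J_def by blast
    then have "x - z = (\<Sum>j<n. R j * [:f j - f' j:]) + p * (q - q')"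
      by (simp add: algebra_simps sum_subtractf smult_diff_left)
    then show ?thesis using JI[of "\<lambda>j. f j - f' j" "q - q'"] by simp
  qed
  have Jsmult: "smult c x \<in> J" if xJ: "x \<in> J" for c x
  proof -
    obtain f q where "x = (\<Sum>j<n. R j * [:f j:]) + p * q" using xJ unfolding J_def by blast
    then have "smult c x = (\<Sum>j<n. R j * [:c * f j:]) + p * smult c q"
      by (simp add: smult_add_right smult_sum2)
    then show ?thesis using JI[of "\<lambda>j. c * f j" "smult c q"] by (simp only:)
  qed
  \<comment> \<open>Multiplication by the variable acts on the coefficient vectors through
    \<open>B\<close>, up to a multiple of \<open>p\<close>; this is the adjugate identity for
    \<open>R\<close>.\<close>
  have JX: "[:0, 1:] * x \<in> J" if xJ: "x \<in> J" for x
  proof -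
    obtain f q where x: "x = (\<Sum>j<n. R j * [:f j:]) + p * q" using xJ unfolding J_def by blast
    have "[:0, 1:] * (\<Sum>j<n. R j * [:f j:]) = (\<Sum>j<n. ([:0, 1:] * R j) * [:f j:])"
      by (simp only: sum_distrib_left mult.assoc)
    also have "\<dots> = (\<Sum>j<n. (\<Sum>i<n. R i * [:B $$ (i, j) * f j:]) + p * [:v $ j * f j:])"
      using R by (intro sum.cong refl) (simp add: smult_add_right smult_sum2 mult.commute)
    also have "\<dots> = (\<Sum>i<n. \<Sum>j<n. R i * [:B $$ (i, j) * f j:]) + (\<Sum>j<n. p * [:v $ j * f j:])"
      unfolding sum.distrib using sum.swap[of "\<lambda>j i. R i * [:B $$ (i, j) * f j:]" "{..<n}" "{..<n}"] by simp
    also have "\<dots> = (\<Sum>i<n. R i * [:\<Sum>j<n. B $$ (i, j) * f j:]) + p * [:\<Sum>j<n. v $ j * f j:]"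
      by (simp add: smult_sum)
    finally have "[:0, 1:] * x = (\<Sum>i<n. R i * [:\<Sum>j<n. B $$ (i, j) * f j:])
        + p * ([:\<Sum>j<n. v $ j * f j:] + [:0, 1:] * q)"
      unfolding x by (simp only: distrib_left mult_ac add_ac)
    then show ?thesis using JI[of "\<lambda>i. \<Sum>j<n. B $$ (i, j) * f j"] by (simp only:)
  qed
  have zeroJ: "0 \<in> J" unfolding J_def by (intro CollectI exI[of _ "\<lambda>_. 0"] exI[of _ 0]) simp
  have Jadd: "x + z \<in> J" if xz: "x \<in> J" "z \<in> J" for x z
    using Jdiff[OF xz(1) Jdiff[OF zeroJ xz(2)]] by simp
  have Jmult: "r * x \<in> J" if xJ: "x \<in> J" for r x
  proof (induction r)
    case 0 show ?case using zeroJ by simp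
  next
    case (pCons a r)
    have "pCons a r * x = smult a x + [:0, 1:] * (r * x)" by simp
    then show ?case using Jadd[OF Jsmult[OF xJ] JX[OF pCons.IH]] by simp
  qed
  have pJ: "p \<in> J" unfolding J_def by (intro CollectI exI[of _ "\<lambda>_. 0"] exI[of _ 1]) simp
  obtain g where g: "g \<in> J" "g \<noteq> 0" and gdvd: "\<And>q. q \<in> J \<Longrightarrow> g dvd q"
    using pJ p0 Jdiff Jmult by (rule poly_ideal_generator) blast+
  \<comment> \<open>At \<open>mu i\<close> the polynomial \<open>p\<close> vanishes, so a bordered
    characteristic polynomial that is nonzero there exhibits an element of \<open>J\<close> that is
    nonzero there.\<close>
  have g_mu: "poly g (mu i) \<noteq> 0" if i: "i \<in> I" for i
  proof -
    obtain u where u: "u \<in> carrier_vec n" "poly (char_poly (bordered B u v 0)) (mu i) \<noteq> 0"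
      using bordered_avoids_eigenvalue[OF B v y(1-3)[OF i] vy[OF i] y(4)[OF i]] by blast
    have "eigenvalue B (mu i)"
    proof -
      have "B *\<^sub>v y i - mu i \<cdot>\<^sub>v y i = 0\<^sub>v n"
        using y(3)[OF i] smult_one_minus_kernel[OF B y(1)[OF i]] by simp
      then have "B *\<^sub>v y i = mu i \<cdot>\<^sub>v y i"
        using B y(1)[OF i] by (intro eq_vecI) (auto simp: vec_eq_iff)
      then show ?thesis unfolding eigenvalue_def eigenvector_def using B y(1,2)[OF i] by auto
    qed
    then have "poly p (mu i) = 0" unfolding p_def using eigenvalue_root_char_poly[OF B] by blast
    then have "poly (\<Sum>j<n. R j * [:u $ j:]) (mu i) \<noteq> 0" using u(2) unfolding chi[OF u(1)] by simp
    moreover have "g dvd (\<Sum>j<n. R j * [:u $ j:])"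
      by (rule gdvd) (unfold J_def, intro CollectI exI[of _ "\<lambda>j. u $ j"] exI[of _ 0], simp)
    ultimately show ?thesis by (auto elim!: dvdE)
  qed
  have gp: "g dvd pl * (\<Prod>i\<in>I. [:- mu i, 1:] ^ \<beta> i)" using gdvd[OF pJ] p unfolding p_def by simp
  \<comment> \<open>All factors of \<open>p\<close> belonging to the \<open>mu i\<close> are
    cancelled one after the other.\<close>
  have "g dvd pl"
    using I gp g_mu
  proof (induction I rule: finite_induct)
    case (insert i I)
    have "g dvd (pl * (\<Prod>i\<in>I. [:- mu i, 1:] ^ \<beta> i)) * [:- mu i, 1:] ^ \<beta> i"
      using insert.prems(1) insert.hyps by (simp add: mult_ac)
    then have "g dvd pl * (\<Prod>i\<in>I. [:- mu i, 1:] ^ \<beta> i)"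
      by (rule dvd_cancel_linear_power) (use insert.prems(2) in auto)
    then show ?case using insert.IH insert.prems(2) by auto
  qed simp
  then have "g dvd P" using dvd by (rule dvd_trans)
  then have "P \<in> J" using Jmult[OF g(1)] by (metis dvdE mult.commute)
  then obtain f q where fq: "P = (\<Sum>j<n. R j * [:f j:]) + p * q" unfolding J_def by blast
  define u where "u = vec n (\<lambda>j. - f j)"
  have u: "u \<in> carrier_vec n" unfolding u_def by simp
  have chi_u: "char_poly (bordered B u v b) = [:- b, 1:] * p + (\<Sum>j<n. R j * [:f j:])" for b
  proof -
    have "(\<Sum>j<n. R j * [:u $ j:]) = - (\<Sum>j<n. R j * [:f j:])"
      unfolding sum_negf[symmetric] u_def by (intro sum.cong refl) simp
    then show ?thesis unfolding chi[OF u] by simp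
  qed
  define Q where "Q = char_poly (bordered B u v 0)"
  have Q: "degree Q = n + 1" "lead_coeff Q = 1"
    using degree_monic_char_poly[OF bordered_carrier[OF B, of u v 0]] unfolding Q_def by auto
  have QP: "Q - P = p * ([:0, 1:] - q)" unfolding Q_def chi_u fq by (simp add: algebra_simps)
  \<comment> \<open>\<open>Q\<close> and \<open>P\<close> are monic of the same degree
    \<open>n + 1\<close>, so their difference is too short for a nonconstant multiple of
    \<open>p\<close>.\<close>
  have "degree ([:0, 1:] - q) = 0"
  proof (rule ccontr)
    assume d: "degree ([:0, 1:] - q) \<noteq> 0"
    then have "degree (Q - P) = n + degree ([:0, 1:] - q)"
      unfolding QP using p0 by (subst degree_mult_eq) (auto simp: p_deg)
    moreover have "degree (Q - P) < n + 1"
    proof -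
      have "degree (Q - P) \<le> n + 1" by (rule degree_diff_le) (use P Q in auto)
      moreover have "coeff (Q - P) (n + 1) = 0" using P Q by simp
      ultimately show ?thesis
        by (metis Suc_eq_plus1 degree_0 le_neq_implies_less leading_coeff_0_iff zero_less_Suc)
    qed
    ultimately show False using d by simp
  qed
  then obtain c where "[:0, 1:] - q = [:c:]" by (elim degree_eq_zeroE)
  then have "q = [:0, 1:] - [:c:]" by (simp add: algebra_simps)
  then have "P = char_poly (bordered B u v c)"
    unfolding chi_u fq by (simp add: algebra_simps)
  then show ?thesis using that[OF u v, of c] by simp
qed

section \<open>Integrability and antiderivatives\<close>

text \<open>Powers belonging to distinct roots do not interfere: the product over the other roots
  has order \<open>0\<close> at \<open>x a\<close>, so the full order remains in the
  cofactor.\<close>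

lemma prod_linear_powers_dvd:
  fixes P :: "'a::field poly"
  assumes "finite A" and "inj_on x A" and P: "P \<noteq> 0" and ord: "\<And>i. i \<in> A \<Longrightarrow> e i \<le> order (x i) P"
  shows "(\<Prod>i\<in>A. [:- x i, 1:] ^ e i) dvd P"
  using assms(1,2) ord
proof (induction A rule: finite_induct)
  case (insert a A)
  define D where "D = (\<Prod>i\<in>A. [:- x i, 1:] ^ e i)"
  have "D dvd P" unfolding D_def
  proof (rule insert.IH)
    show "inj_on x A" using insert.prems(1) by (rule inj_on_subset) blast
    show "e i \<le> order (x i) P" if "i \<in> A" for i using insert.prems(2) that by blast
  qed
  then obtain q where q: "P = D * q" by (elim dvdE)
  have D0: "D \<noteq> 0" and q0: "q \<noteq> 0" using P q by auto
  have "order (x a) D = (\<Sum>i\<in>A. if x i = x a then e i else 0)"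
    unfolding D_def by (subst order_prod) (auto simp: order_linear_power insert.hyps)
  also have "\<dots> = 0" using insert.prems(1) insert.hyps(2) by (intro sum.neutral) (auto simp: inj_on_def)
  finally have "order (x a) D = 0" .
  then have "order (x a) P = order (x a) q" unfolding q using D0 q0 by (subst order_mult) auto
  then have "e a \<le> order (x a) q" using insert.prems(2)[of a] by simp
  then have "[:- x a, 1:] ^ e a dvd q" using order_1[of "x a" q] by (rule power_le_dvd[rotated])
  then have "D * [:- x a, 1:] ^ e a dvd D * q" by (rule mult_dvd_mono[OF dvd_refl])
  then show ?case unfolding q D_def using insert.hyps by (simp add: mult.commute)
qed simp

lemma exists_antiderivative:
  fixes p :: "'a::field_char_0 poly"
  obtains Q where "pderiv Q = p"
proof -
  have "pderiv (\<Sum>i\<le>degree p. monom (coeff p i / of_nat (Suc i)) (Suc i)) = (\<Sum>i\<le>degree p. monom (coeff p i) i)"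
    unfolding pderiv_sum by (intro sum.cong refl) (simp add: pderiv_monom del: of_nat_Suc)
  then show ?thesis using that unfolding poly_as_sum_of_monoms by blast
qed

lemma degree_antiderivative:
  fixes P :: "'a::field_char_0 poly"
  assumes "pderiv P = smult (of_nat (n + 1)) p" and p: "degree p = n" "lead_coeff p = 1"
  shows "degree P = n + 1" "lead_coeff P = 1"
proof -
  have "degree (pderiv P) = n" unfolding assms(1) using p(1) by (simp del: of_nat_Suc)
  moreover have "pderiv P \<noteq> 0" unfolding assms(1) using p(2) by (auto simp del: of_nat_Suc)
  ultimately have "degree P \<noteq> 0" "degree P - 1 = n" by (simp_all add: pderiv_eq_0_iff degree_pderiv)
  then show deg: "degree P = n + 1" by simp
  have "coeff (pderiv P) n = of_nat (n + 1)" unfolding assms(1) using p by (simp del: of_nat_Suc)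
  then have "of_nat (n + 1) * coeff P (n + 1) = of_nat (n + 1)" unfolding coeff_pderiv by simp
  then show "lead_coeff P = 1" unfolding deg by (simp del: of_nat_Suc)
qed

lemma order_antiderivative:
  fixes P :: "'a::field_char_0 poly"
  assumes "pderiv P = smult c p" "c \<noteq> 0" "poly P x = 0" "P \<noteq> 0"
  shows "order x P = Suc (order x p)"
  using order_pderiv[of P x] assms by (simp add: order_smult)

lemma integrable_mat_iff:
  assumes "B \<in> carrier_mat n n"
  shows "integrable_mat n B \<longleftrightarrow> (\<exists>u\<in>carrier_vec n. \<exists>v\<in>carrier_vec n. \<exists>b.
     char_poly B = smult (1 / of_nat (n + 1)) (pderiv (char_poly (bordered B u v b))))"
  using bordered_carrier[OF assms]
  unfolding integrable_mat_def integral_of_mat_def bordered_def by blast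

lemma integrable_matE:
  fixes B :: "'a::field_char_0 mat"
  assumes B: "B \<in> carrier_mat n n" and "integrable_mat n B"
  obtains P where "pderiv P = smult (of_nat (n + 1)) (char_poly B)" "degree P = n + 1" "lead_coeff P = 1"
    "\<And>e. kernel_dim (B - e \<cdot>\<^sub>m 1\<^sub>m n) > 1 \<Longrightarrow> poly P e = 0"
proof -
  obtain u v b where u: "u \<in> carrier_vec n" and v: "v \<in> carrier_vec n"
    and eq: "char_poly B = smult (1 / of_nat (n + 1)) (pderiv (char_poly (bordered B u v b)))"
    using assms(2) unfolding integrable_mat_iff[OF B] by blast
  show ?thesis
  proof (rule that[of "char_poly (bordered B u v b)"])
    show "pderiv (char_poly (bordered B u v b)) = smult (of_nat (n + 1)) (char_poly B)"
      unfolding eq by (simp del: of_nat_Suc)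
    show "degree (char_poly (bordered B u v b)) = n + 1" "lead_coeff (char_poly (bordered B u v b)) = 1"
      using degree_monic_char_poly[OF bordered_carrier[OF B, of u v b]] by auto
    show "poly (char_poly (bordered B u v b)) e = 0" if "kernel_dim (B - e \<cdot>\<^sub>m 1\<^sub>m n) > 1" for e
      by (rule char_poly_bordered_root[OF B u v that])
  qed
qed

lemma degree_prod_linear_powers:
  fixes x :: "'b \<Rightarrow> 'a::field"
  shows "degree (\<Prod>i\<in>A. [:- x i, 1:] ^ e i) = sum e A"
  by (subst degree_prod_eq_sum_degree) (auto simp: degree_power_eq)

lemma lead_coeff_prod_linear_powers:
  fixes x :: "'b \<Rightarrow> 'a::field"
  shows "lead_coeff (\<Prod>i\<in>A. [:- x i, 1:] ^ e i) = 1"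
  unfolding lead_coeff_prod lead_coeff_power by simp

lemma sum_indicator_inj:
  assumes "finite A" "inj_on x A" "a \<in> A"
  shows "(\<Sum>q\<in>A. if x q = x a then f q else 0) = (f a :: 'b::comm_monoid_add)"
proof -
  have "x q = x a \<longleftrightarrow> q = a" if "q \<in> A" for q
    using inj_on_eq_iff[OF assms(2) that assms(3)] .
  then have "(\<Sum>q\<in>A. if x q = x a then f q else 0) = (\<Sum>q\<in>A. if q = a then f q else 0)"
    by (intro sum.cong) simp_all
  then show ?thesis using assms by simp
qed

lemma sum_indicator_disjoint:
  "t \<notin> x ` A \<Longrightarrow> (\<Sum>q\<in>A. if x q = t then f q else 0) = (0 :: 'b::comm_monoid_add)"
  by (intro sum.neutral) auto

section \<open>The matrix class and the integrability criterion\<close>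

locale multiplicities =
  fixes m k n :: nat and \<alpha> \<beta> :: "nat \<Rightarrow> nat"
  assumes alpha: "\<And>j. j \<in> {1..m} \<Longrightarrow> \<alpha> j \<ge> 2" and beta: "\<And>i. i \<in> {1..k} \<Longrightarrow> \<beta> i \<ge> 1"
    and n: "n = (\<Sum>j=1..m. \<alpha> j) + (\<Sum>i=1..k. \<beta> i)"
begin

definition spec_poly :: "(nat \<Rightarrow> 'a::field) \<Rightarrow> (nat \<Rightarrow> 'a) \<Rightarrow> 'a poly" where
  "spec_poly lam mu = (\<Prod>j=1..m. [:- lam j, 1:] ^ \<alpha> j) * (\<Prod>i=1..k. [:- mu i, 1:] ^ \<beta> i)"

text \<open>Fixing the eigenvalues and factorising the characteristic polynomial replaces the
  conditions on orders and eigenvalues in \<open>eigen_class\<close>.\<close>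

definition in_class :: "'a::field mat \<Rightarrow> (nat \<Rightarrow> 'a) \<Rightarrow> (nat \<Rightarrow> 'a) \<Rightarrow> bool" where
  "in_class B lam mu \<longleftrightarrow> B \<in> carrier_mat n n \<and>
     inj_on lam {1..m} \<and> inj_on mu {1..k} \<and> lam ` {1..m} \<inter> mu ` {1..k} = {} \<and>
     char_poly B = spec_poly lam mu \<and>
     (\<forall>j\<in>{1..m}. kernel_dim (B - lam j \<cdot>\<^sub>m 1\<^sub>m n) > 1) \<and>
     (\<forall>i\<in>{1..k}. kernel_dim (B - mu i \<cdot>\<^sub>m 1\<^sub>m n) = 1)"

lemma order_spec_poly:
  assumes inj: "inj_on lam {1..m}" "inj_on mu {1..k}" "lam ` {1..m} \<inter> mu ` {1..k} = {}"
  shows "j \<in> {1..m} \<Longrightarrow> order (lam j) (spec_poly lam mu) = \<alpha> j"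
    and "i \<in> {1..k} \<Longrightarrow> order (mu i) (spec_poly lam mu) = \<beta> i"
proof -
  have ord: "order t (spec_poly lam mu)
      = (\<Sum>j=1..m. if lam j = t then \<alpha> j else 0) + (\<Sum>i=1..k. if mu i = t then \<beta> i else 0)" for t
    unfolding spec_poly_def by (subst order_mult) (auto simp: order_prod order_linear_power)
  show "order (lam j) (spec_poly lam mu) = \<alpha> j" if "j \<in> {1..m}" for j
  proof -
    have nm: "lam j \<notin> mu ` {1..k}" using inj(3) that by blast
    show ?thesis unfolding ord sum_indicator_inj[OF finite_atLeastAtMost inj(1) that] sum_indicator_disjoint[OF nm] by simp
  qed
  show "order (mu i) (spec_poly lam mu) = \<beta> i" if "i \<in> {1..k}" for i
  proof -
    have nm: "mu i \<notin> lam ` {1..m}" using inj(3) that by blast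
    show ?thesis unfolding ord sum_indicator_inj[OF finite_atLeastAtMost inj(2) that] sum_indicator_disjoint[OF nm] by simp
  qed
qed

lemma degree_spec_poly: "degree (spec_poly lam mu) = n" "lead_coeff (spec_poly lam mu) = 1"
proof -
  show "degree (spec_poly lam mu) = n"
    unfolding spec_poly_def n by (subst degree_mult_eq) (auto simp: degree_prod_linear_powers)
  show "lead_coeff (spec_poly lam mu) = 1"
    unfolding spec_poly_def lead_coeff_mult lead_coeff_prod_linear_powers by simp
qed

text \<open>The prescribed orders already account for the whole degree \<open>n\<close>, so a monic
  characteristic polynomial with these orders is \<open>spec_poly\<close>.\<close>

lemma eigen_class_iff: "B \<in> eigen_class n m \<alpha> k \<beta> \<longleftrightarrow> (\<exists>lam mu. in_class B lam mu)"
proof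
  assume "B \<in> eigen_class n m \<alpha> k \<beta>"
  then obtain lam mu where B: "B \<in> carrier_mat n n"
    and inj: "inj_on lam {1..m}" "inj_on mu {1..k}" "lam ` {1..m} \<inter> mu ` {1..k} = {}"
    and l: "\<And>j. j \<in> {1..m} \<Longrightarrow> order (lam j) (char_poly B) = \<alpha> j"
      "\<And>j. j \<in> {1..m} \<Longrightarrow> kernel_dim (B - lam j \<cdot>\<^sub>m 1\<^sub>m n) > 1"
    and u: "\<And>i. i \<in> {1..k} \<Longrightarrow> order (mu i) (char_poly B) = \<beta> i"
      "\<And>i. i \<in> {1..k} \<Longrightarrow> kernel_dim (B - mu i \<cdot>\<^sub>m 1\<^sub>m n) = 1"
    unfolding eigen_class_def by blast
  define p where "p = char_poly B"
  have p: "degree p = n" "lead_coeff p = 1" using degree_monic_char_poly[OF B] unfolding p_def by auto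
  then have p0: "p \<noteq> 0" by auto
  \<comment> \<open>Indexing by the disjoint sum treats both families of eigenvalues as one family
    of distinct roots.\<close>
  define x where "x = case_sum lam mu"
  define e where "e = case_sum \<alpha> \<beta>"
  have "(\<Prod>s\<in>{1..m} <+> {1..k}. [:- x s, 1:] ^ e s) dvd p"
  proof (rule prod_linear_powers_dvd[OF _ _ p0])
    have ne: "lam a \<noteq> mu b" "mu b \<noteq> lam a" if "a \<in> {1..m}" "b \<in> {1..k}" for a b
      using inj(3) that by (metis IntI empty_iff imageI)+
    show "inj_on x ({1..m} <+> {1..k})"
    proof (rule inj_onI)
      fix s t assume st: "s \<in> {1..m} <+> {1..k}" "t \<in> {1..m} <+> {1..k}" "x s = x t"
      show "s = t"
      proof (cases s; cases t)
        fix a b assume "s = Inl a" "t = Inl b"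
        then show ?thesis using st inj_onD[OF inj(1), of a b] unfolding x_def by auto
      next
        fix a b assume "s = Inr a" "t = Inr b"
        then show ?thesis using st inj_onD[OF inj(2), of a b] unfolding x_def by auto
      qed (use st ne in \<open>auto simp: x_def\<close>)
    qed
    show "e s \<le> order (x s) p" if "s \<in> {1..m} <+> {1..k}" for s
      using that l(1) u(1) unfolding x_def e_def p_def by auto
  qed simp
  also have "(\<Prod>s\<in>{1..m} <+> {1..k}. [:- x s, 1:] ^ e s) = spec_poly lam mu"
    unfolding spec_poly_def x_def e_def by (subst prod.Plus) (auto simp: o_def)
  finally obtain q where q: "p = spec_poly lam mu * q" by (elim dvdE)
  then have "q \<noteq> 0" "spec_poly lam mu \<noteq> 0" using p0 by auto
  then have "degree q = 0" using p(1) degree_spec_poly(1)[of lam mu] unfolding q by (simp add: degree_mult_eq)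
  moreover have "lead_coeff q = 1" using p(2) degree_spec_poly(2)[of lam mu] unfolding q lead_coeff_mult by simp
  ultimately have "q = 1" by (metis degree_eq_zeroE lead_coeff_pCons(2) one_pCons pCons_0_0 lead_coeff_pCons(1) zero_neq_one)
  then have "char_poly B = spec_poly lam mu" using q unfolding p_def by simp
  then have "in_class B lam mu" unfolding in_class_def using B inj l(2) u(2) by blast
  then show "\<exists>lam mu. in_class B lam mu" by blast
next
  assume "\<exists>lam mu. in_class B lam mu"
  then obtain lam mu where c: "in_class B lam mu" by blast
  then have B: "B \<in> carrier_mat n n" and p: "char_poly B = spec_poly lam mu"
    and inj: "inj_on lam {1..m}" "inj_on mu {1..k}" "lam ` {1..m} \<inter> mu ` {1..k} = {}"
    unfolding in_class_def by auto
  note ord = order_spec_poly[OF inj]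
  have ev: "eigenvalue B t" if "order t (char_poly B) \<noteq> 0" for t
    using that order_root[of "char_poly B" t] eigenvalue_root_char_poly[OF B, of t] by blast
  have l: "order (lam j) (char_poly B) = \<alpha> j" "order (lam j) (char_poly B) \<noteq> 0" if "j \<in> {1..m}" for j
    using ord(1)[OF that] alpha[OF that] unfolding p by simp_all
  have u: "order (mu i) (char_poly B) = \<beta> i" "order (mu i) (char_poly B) \<noteq> 0" if "i \<in> {1..k}" for i
    using ord(2)[OF that] beta[OF that] unfolding p by simp_all
  have ker: "\<forall>j\<in>{1..m}. kernel_dim (B - lam j \<cdot>\<^sub>m 1\<^sub>m n) > 1"
    "\<forall>i\<in>{1..k}. kernel_dim (B - mu i \<cdot>\<^sub>m 1\<^sub>m n) = 1"
    using c unfolding in_class_def by blast+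
  show "B \<in> eigen_class n m \<alpha> k \<beta>"
    unfolding eigen_class_def
  proof (rule CollectI, rule conjI[OF B], rule exI[of _ lam], rule exI[of _ mu], intro conjI ballI inj)
    fix j assume j: "j \<in> {1..m}"
    show "eigenvalue B (lam j)" by (rule ev[OF l(2)[OF j]])
    show "order (lam j) (char_poly B) = \<alpha> j" by (rule l(1)[OF j])
    show "kernel_dim (B - lam j \<cdot>\<^sub>m 1\<^sub>m n) > 1" using ker(1) j by blast
  next
    fix i assume i: "i \<in> {1..k}"
    show "eigenvalue B (mu i)" by (rule ev[OF u(2)[OF i]])
    show "order (mu i) (char_poly B) = \<beta> i" by (rule u(1)[OF i])
    show "kernel_dim (B - mu i \<cdot>\<^sub>m 1\<^sub>m n) = 1" using ker(2) i by blast
  qed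
qed

text \<open>Integrability depends only on the spectrum. An integral has a characteristic polynomial
  that vanishes at every \<open>lam j\<close>; conversely, a vanishing antiderivative is divisible
  by the factor of the \<open>lam j\<close> and is therefore realised by a bordering.\<close>

lemma integrable_iff_antiderivative:
  fixes B :: "'a::field_char_0 mat"
  assumes c: "in_class B lam mu"
  shows "integrable_mat n B \<longleftrightarrow>
    (\<exists>P. pderiv P = smult (of_nat (n + 1)) (spec_poly lam mu) \<and> (\<forall>j\<in>{1..m}. poly P (lam j) = 0))"
proof
  have B: "B \<in> carrier_mat n n" and p: "char_poly B = spec_poly lam mu"
    and inj: "inj_on lam {1..m}" "inj_on mu {1..k}" "lam ` {1..m} \<inter> mu ` {1..k} = {}"
    and ker: "\<And>j. j \<in> {1..m} \<Longrightarrow> kernel_dim (B - lam j \<cdot>\<^sub>m 1\<^sub>m n) > 1"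
      "\<And>i. i \<in> {1..k} \<Longrightarrow> kernel_dim (B - mu i \<cdot>\<^sub>m 1\<^sub>m n) = 1"
    using c unfolding in_class_def by auto
  {
    assume "integrable_mat n B"
    then show "\<exists>P. pderiv P = smult (of_nat (n + 1)) (spec_poly lam mu) \<and> (\<forall>j\<in>{1..m}. poly P (lam j) = 0)"
      by (rule integrable_matE[OF B]) (use ker(1) p in auto)
  next
    assume "\<exists>P. pderiv P = smult (of_nat (n + 1)) (spec_poly lam mu) \<and> (\<forall>j\<in>{1..m}. poly P (lam j) = 0)"
    then obtain P where P: "pderiv P = smult (of_nat (n + 1)) (spec_poly lam mu)"
      and root: "\<And>j. j \<in> {1..m} \<Longrightarrow> poly P (lam j) = 0" by blast
    note degP = degree_antiderivative[OF P degree_spec_poly]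
    then have P0: "P \<noteq> 0" by auto
    have "(\<Prod>j=1..m. [:- lam j, 1:] ^ \<alpha> j) dvd P"
    proof (rule prod_linear_powers_dvd[OF _ inj(1) P0])
      fix j assume j: "j \<in> {1..m}"
      have "order (lam j) P = Suc (order (lam j) (spec_poly lam mu))"
        by (rule order_antiderivative[OF P _ root[OF j] P0]) (simp del: of_nat_Suc)
      then show "\<alpha> j \<le> order (lam j) P" using order_spec_poly(1)[OF inj j] by simp
    qed simp
    then obtain u v b where u: "u \<in> carrier_vec n" and v: "v \<in> carrier_vec n"
      and chi: "char_poly (bordered B u v b) = P"
      using bordered_char_poly_realizable[OF B finite_atLeastAtMost p[unfolded spec_poly_def] ker(2) degP]
      by blast
    show "integrable_mat n B"
      unfolding integrable_mat_iff[OF B]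
    proof (intro bexI exI)
      show "char_poly B = smult (1 / of_nat (n + 1)) (pderiv (char_poly (bordered B u v b)))"
        unfolding chi P p by (simp del: of_nat_Suc)
    qed (fact u v)+
  }
qed

end

section \<open>Jordan matrices with prescribed kernels\<close>

lemma sum_list_concat_replicate:
  "sum_list (map f (concat (map (\<lambda>j. replicate (e j) (x j)) js))) = (\<Sum>j\<leftarrow>js. e j * f (x j))"
  for f :: "'b \<Rightarrow> nat"
  by (induction js) (simp_all add: sum_list_replicate map_replicate)

lemma prod_list_concat_replicate:
  "prod_list (map f (concat (map (\<lambda>j. replicate (e j) (x j)) js))) = (\<Prod>j\<leftarrow>js. f (x j) ^ e j)"
  for f :: "'b \<Rightarrow> 'c::comm_monoid_mult"
proof (induction js)
  case (Cons j js)
  have "prod_list (replicate c y) = y ^ c" for c and y :: 'c by (induction c) simp_all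
  then show ?case using Cons by simp
qed simp

lemma sum_list_filter_snd:
  "(\<Sum>c\<leftarrow>map fst [(c, a)\<leftarrow>xs. a = t]. min 1 c) = (\<Sum>x\<leftarrow>xs. if snd x = t then min 1 (fst x) else (0 :: nat))"
  by (induction xs) auto

text \<open>Every block with eigenvalue \<open>t\<close> contributes one dimension;
  \<open>min 1\<close> accounts for blocks of size \<open>0\<close>.\<close>

lemma kernel_dim_jordan_matrix:
  fixes t :: "'a::field"
  shows "kernel_dim (jordan_matrix xs - t \<cdot>\<^sub>m 1\<^sub>m (sum_list (map fst xs)))
    = (\<Sum>x\<leftarrow>xs. if snd x = t then min 1 (fst x) else 0)"
proof -
  have "char_matrix (jordan_matrix xs) t = jordan_matrix xs - t \<cdot>\<^sub>m 1\<^sub>m (sum_list (map fst xs))"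
    unfolding char_matrix_def by (intro eq_matI) auto
  moreover have "char_matrix (jordan_matrix xs) t ^\<^sub>m 1 = char_matrix (jordan_matrix xs) t"
    unfolding char_matrix_def by (simp add: left_mult_one_mat')
  ultimately have "kernel_dim (jordan_matrix xs - t \<cdot>\<^sub>m 1\<^sub>m (sum_list (map fst xs)))
      = dim_gen_eigenspace (jordan_matrix xs) t 1"
    unfolding dim_gen_eigenspace_def by simp
  then show ?thesis unfolding dim_gen_eigenspace_jordan_matrix sum_list_filter_snd .
qed

section \<open>Existence and obstruction\<close>

context multiplicities
begin

text \<open>\<open>\<alpha> j\<close> blocks of size \<open>1\<close> for \<open>lam j\<close> give
  a kernel of dimension \<open>\<alpha> j\<close>, at least two, and a single block of size
  \<open>\<beta> i\<close> for \<open>mu i\<close> gives a line.\<close>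

lemma in_class_exists:
  fixes lam mu :: "nat \<Rightarrow> 'a::field"
  assumes inj: "inj_on lam {1..m}" "inj_on mu {1..k}" "lam ` {1..m} \<inter> mu ` {1..k} = {}"
  obtains B where "in_class B lam mu"
proof -
  define xs where "xs = concat (map (\<lambda>j. replicate (\<alpha> j) (1 :: nat, lam j)) [1..<Suc m])
      @ map (\<lambda>i. (\<beta> i, mu i)) [1..<Suc k]"
  have upt: "{1..<Suc c} = {1..c}" for c by auto
  have sum_xs: "(\<Sum>x\<leftarrow>xs. f x) = (\<Sum>j=1..m. \<alpha> j * f (1, lam j)) + (\<Sum>i=1..k. f (\<beta> i, mu i))"
    for f :: "nat \<times> 'a \<Rightarrow> nat"
    unfolding xs_def map_append sum_list_append sum_list_concat_replicate map_map
    by (simp only: interv_sum_list_conv_sum_set_nat set_upt upt o_def)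
  have prod_xs: "(\<Prod>x\<leftarrow>xs. f x) = (\<Prod>j=1..m. f (1, lam j) ^ \<alpha> j) * (\<Prod>i=1..k. f (\<beta> i, mu i))"
    for f :: "nat \<times> 'a \<Rightarrow> 'a poly"
    unfolding xs_def map_append prod_list.append prod_list_concat_replicate map_map
    by (simp only: prod.distinct_set_conv_list[symmetric] distinct_upt set_upt upt o_def)
  define B where "B = jordan_matrix xs"
  have dim: "sum_list (map fst xs) = n" unfolding sum_xs n by simp
  have B: "B \<in> carrier_mat n n" unfolding B_def using dim by auto
  have p: "char_poly B = spec_poly lam mu"
    unfolding B_def jordan_matrix_char_poly prod_xs spec_poly_def by simp
  have ker: "kernel_dim (B - t \<cdot>\<^sub>m 1\<^sub>m n)
      = (\<Sum>j=1..m. if lam j = t then \<alpha> j else 0) + (\<Sum>i=1..k. if mu i = t then min 1 (\<beta> i) else 0)" for t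
  proof -
    have "(\<Sum>j=1..m. \<alpha> j * (if lam j = t then min 1 1 else 0)) = (\<Sum>j=1..m. if lam j = t then \<alpha> j else 0)"
      by (intro sum.cong refl) simp
    moreover have "kernel_dim (B - t \<cdot>\<^sub>m 1\<^sub>m n) = (\<Sum>x\<leftarrow>xs. if snd x = t then min 1 (fst x) else 0)"
      using kernel_dim_jordan_matrix[of xs t] unfolding B_def dim .
    ultimately show ?thesis unfolding sum_xs fst_conv snd_conv by (simp only:)
  qed
  have ker_lam: "kernel_dim (B - lam j \<cdot>\<^sub>m 1\<^sub>m n) > 1" if "j \<in> {1..m}" for j
  proof -
    have nm: "lam j \<notin> mu ` {1..k}" using inj(3) that by blast
    have "kernel_dim (B - lam j \<cdot>\<^sub>m 1\<^sub>m n) = \<alpha> j"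
      unfolding ker sum_indicator_inj[OF finite_atLeastAtMost inj(1) that] sum_indicator_disjoint[OF nm] by simp
    then show ?thesis using alpha[OF that] by simp
  qed
  have ker_mu: "kernel_dim (B - mu i \<cdot>\<^sub>m 1\<^sub>m n) = 1" if "i \<in> {1..k}" for i
  proof -
    have nm: "mu i \<notin> lam ` {1..m}" using inj(3) that by blast
    have "kernel_dim (B - mu i \<cdot>\<^sub>m 1\<^sub>m n) = min 1 (\<beta> i)"
      unfolding ker sum_indicator_inj[OF finite_atLeastAtMost inj(2) that] sum_indicator_disjoint[OF nm] by simp
    then show ?thesis using beta[OF that] by simp
  qed
  have "in_class B lam mu" unfolding in_class_def using B inj p ker_lam ker_mu by blast
  then show ?thesis by (rule that)
qed

text \<open>The antiderivative of degree \<open>n + 1\<close> has a zero of order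
  \<open>\<alpha> j + 1\<close> at each \<open>lam j\<close>. The additive form of the bound avoids
  subtraction of natural numbers.\<close>

lemma integrable_bound:
  fixes B :: "'a::field_char_0 mat"
  assumes c: "in_class B lam mu" and int: "integrable_mat n B"
  shows "m + (\<Sum>j=1..m. \<alpha> j) \<le> n + 1"
proof -
  have inj: "inj_on lam {1..m}" "inj_on mu {1..k}" "lam ` {1..m} \<inter> mu ` {1..k} = {}"
    using c unfolding in_class_def by auto
  obtain P where P: "pderiv P = smult (of_nat (n + 1)) (spec_poly lam mu)"
    and root: "\<And>j. j \<in> {1..m} \<Longrightarrow> poly P (lam j) = 0"
    using int unfolding integrable_iff_antiderivative[OF c] by blast
  have degP: "degree P = n + 1" "lead_coeff P = 1"
    using degree_antiderivative[OF P degree_spec_poly] by auto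
  then have P0: "P \<noteq> 0" by auto
  have "(\<Prod>j=1..m. [:- lam j, 1:] ^ Suc (\<alpha> j)) dvd P"
  proof (rule prod_linear_powers_dvd[OF _ inj(1) P0])
    fix j assume j: "j \<in> {1..m}"
    have "order (lam j) P = Suc (order (lam j) (spec_poly lam mu))"
      by (rule order_antiderivative[OF P _ root[OF j] P0]) (simp del: of_nat_Suc)
    then show "Suc (\<alpha> j) \<le> order (lam j) P" using order_spec_poly(1)[OF inj j] by simp
  qed simp
  then have "degree (\<Prod>j=1..m. [:- lam j, 1:] ^ Suc (\<alpha> j)) \<le> n + 1"
    using dvd_imp_degree_le[OF _ P0] degP by metis
  moreover have "degree (\<Prod>j=1..m. [:- lam j, 1:] ^ Suc (\<alpha> j)) = (\<Sum>j=1..m. Suc (\<alpha> j))"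
    by (rule degree_prod_linear_powers)
  moreover have "(\<Sum>j=1..m. Suc (\<alpha> j)) = m + (\<Sum>j=1..m. \<alpha> j)"
    unfolding Suc_eq_plus1 sum.distrib by simp
  ultimately show ?thesis by simp
qed

text \<open>The constant of integration is free, and there is at most one value to be made
  zero.\<close>

lemma integrable_if_at_most_one:
  fixes B :: "'a::field_char_0 mat"
  assumes c: "in_class B lam mu" and m: "m \<le> 1"
  shows "integrable_mat n B"
proof -
  obtain Q where Q: "pderiv Q = smult (of_nat (n + 1)) (spec_poly lam mu)"
    using exists_antiderivative by blast
  \<comment> \<open>For \<open>m = 0\<close> the value \<open>lam 1\<close> is arbitrary, but then
    no vanishing is required.\<close>
  define P where "P = Q - [:poly Q (lam 1):]"
  have "pderiv P = smult (of_nat (n + 1)) (spec_poly lam mu)"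
    unfolding P_def pderiv_diff Q by (simp add: pderiv_pCons del: of_nat_Suc)
  moreover have "poly P (lam j) = 0" if "j \<in> {1..m}" for j
  proof -
    have "j = 1" using that m by auto
    then show ?thesis by (simp add: P_def)
  qed
  ultimately show ?thesis unfolding integrable_iff_antiderivative[OF c] by blast
qed

text \<open>The first \<open>m\<close> zeros of a suitable \<open>P\<close> become the
  \<open>lam j\<close>, the other zeros are simple, and the critical points that are not zeros
  become the \<open>mu i\<close>.\<close>

lemma exists_integrable:
  fixes emb :: "'a::{alg_closed_field, field_char_0} \<Rightarrow> complex"
  assumes emb: "field_hom emb" and m: "m \<le> (\<Sum>i=1..k. \<beta> i) + 1"
  obtains B :: "'a mat" and lam mu where "in_class B lam mu" "integrable_mat n B"
proof -
  define N where "N = (\<Sum>i=1..k. \<beta> i) + 1"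
  \<comment> \<open>Weights are indexed from \<open>0\<close>, multiplicities from \<open>1\<close>;
    the \<open>+ 1\<close> is the order gained by integration.\<close>
  define w where "w r = (if r < m then \<alpha> (Suc r) + 1 else 1)" for r
  have N: "N > 0" "(\<Sum>i=1..k. \<beta> i) = N - 1" and mN: "m \<le> N" using m unfolding N_def by auto
  have w: "w r > 0" for r unfolding w_def by simp
  obtain s mu :: "nat \<Rightarrow> 'a" where s: "inj_on s {..<N}" and mu: "inj_on mu {1..k}"
    and disj: "s ` {..<N} \<inter> mu ` {1..k} = {}"
    and D: "wderiv (\<lambda>r. of_nat (w r)) s N = smult (of_nat (\<Sum>r<N. w r)) (\<Prod>i=1..k. [:- mu i, 1:] ^ \<beta> i)"
    by (rule separated_zeros_and_critical_points[where w = w, OF emb N(1) w N(2)])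
  define lam where "lam j = s (j - 1)" for j
  have lam_img: "lam ` {1..m} \<subseteq> s ` {..<N}" unfolding lam_def using mN by auto
  have "inj_on lam {1..m}"
  proof (rule inj_onI)
    fix i j assume ij: "i \<in> {1..m}" "j \<in> {1..m}" "lam i = lam j"
    then have "i - 1 = j - 1" using inj_onD[OF s, of "i - 1" "j - 1"] mN unfolding lam_def by auto
    then show "i = j" using ij by auto
  qed
  moreover have "lam ` {1..m} \<inter> mu ` {1..k} = {}" using lam_img disj by blast
  ultimately obtain B where B: "in_class B lam mu" using in_class_exists mu by blast
  define P where "P = (\<Prod>r<N. [:- s r, 1:] ^ w r)"
  have sum_w: "(\<Sum>r<N. w r) = n + 1"
  proof -
    have "(\<Sum>r<N. w r) = (\<Sum>r<N. 1 + (if r < m then \<alpha> (Suc r) else 0))"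
      by (intro sum.cong) (auto simp: w_def)
    also have "\<dots> = N + (\<Sum>r<N. if r < m then \<alpha> (Suc r) else 0)" unfolding sum.distrib by simp
    also have "(\<Sum>r<N. if r < m then \<alpha> (Suc r) else 0) = (\<Sum>r<m. \<alpha> (Suc r))"
      using mN by (intro sum.mono_neutral_cong_right) auto
    also have "\<dots> = (\<Sum>j=1..m. \<alpha> j)" by (simp add: sum.atLeast1_atMost_eq)
    finally show ?thesis unfolding n N_def by simp
  qed
  have "(\<Prod>r<N. [:- s r, 1:] ^ (w r - 1)) = (\<Prod>r<m. [:- s r, 1:] ^ \<alpha> (Suc r))"
    using mN by (intro prod.mono_neutral_cong_right) (auto simp: w_def)
  also have "\<dots> = (\<Prod>j=1..m. [:- lam j, 1:] ^ \<alpha> j)"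
    by (simp add: prod.atLeast1_atMost_eq lam_def)
  finally have simple: "(\<Prod>r<N. [:- s r, 1:] ^ (w r - 1)) = (\<Prod>j=1..m. [:- lam j, 1:] ^ \<alpha> j)" .
  have "pderiv P = smult (of_nat (n + 1)) (spec_poly lam mu)"
    unfolding P_def pderiv_prod_linear_powers[OF w] D simple sum_w spec_poly_def by (rule mult_smult_right)
  moreover have "poly P (lam j) = 0" if "j \<in> {1..m}" for j
    unfolding P_def poly_prod
  proof (rule prod_zero)
    show "\<exists>r\<in>{..<N}. poly ([:- s r, 1:] ^ w r) (lam j) = 0"
      using that mN w[of "j - 1"] by (intro bexI[of _ "j - 1"]) (auto simp: lam_def)
  qed simp
  ultimately have "integrable_mat n B" unfolding integrable_iff_antiderivative[OF B] by blast
  then show ?thesis using that B by blast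
qed

text \<open>An antiderivative vanishing at the two eigenvalues \<open>0\<close> and \<open>1\<close>
  would make the integral of the characteristic polynomial between them zero, which its sign over
  the reals forbids.\<close>

lemma exists_non_integrable:
  assumes m: "m \<ge> 2"
  obtains B :: "'a::field_char_0 mat" and lam mu where "in_class B lam mu" "\<not> integrable_mat n B"
proof -
  text \<open>The eigenvalues are natural numbers, the first two being \<open>0\<close> and \<open>1\<close>, so that the
    characteristic polynomial has no root strictly between them.\<close>
  define c where "c j = (if j \<le> 2 then j - 1 else j)" for j :: nat
  define lam :: "nat \<Rightarrow> 'a" where "lam j = of_nat (c j)" for j
  define mu :: "nat \<Rightarrow> 'a" where "mu i = of_nat (m + i)" for i
  have c_inj: "c i = c j \<Longrightarrow> i = j" if "i \<ge> 1" "j \<ge> 1" for i j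
    using that unfolding c_def by (auto split: if_splits)
  have c_le: "c j \<le> m" if "j \<in> {1..m}" for j using that unfolding c_def by auto
  have "inj_on lam {1..m}"
  proof (rule inj_onI)
    fix i j assume "i \<in> {1..m}" "j \<in> {1..m}" "lam i = lam j"
    then show "i = j" using c_inj[of i j] by (simp add: lam_def)
  qed
  moreover have "inj_on mu {1..k}" unfolding mu_def by (auto simp: inj_on_def)
  moreover have "lam ` {1..m} \<inter> mu ` {1..k} = {}"
  proof -
    have "lam j \<noteq> mu i" if "j \<in> {1..m}" "i \<in> {1..k}" for i j
      using c_le[OF that(1)] that(2) unfolding lam_def mu_def of_nat_eq_iff by auto
    then show ?thesis by blast
  qed
  ultimately obtain B where B: "in_class B lam mu" using in_class_exists by blast
  have "\<not> integrable_mat n B"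
  proof
    assume "integrable_mat n B"
    then obtain P where P: "pderiv P = smult (of_nat (n + 1)) (spec_poly lam mu)"
      and root: "\<And>j. j \<in> {1..m} \<Longrightarrow> poly P (lam j) = 0"
      unfolding integrable_iff_antiderivative[OF B] by blast
    have P01: "poly P 0 = 0" "poly P 1 = 0" using root[of 1] root[of 2] m by (auto simp: lam_def c_def)
    define pr where "pr = spec_poly (\<lambda>j. of_nat (c j) :: real) (\<lambda>i. of_nat (m + i))"
    \<comment> \<open>The field carries no order. Since the chosen polynomial has rational
      coefficients, the vanishing of its integral is carried over to \<open>real\<close> through the
      common copy of the rationals.\<close>
    define G :: "('a \<times> real) set" where "G = {(of_rat q, of_rat q) | q. True}"
    have G: "subring_rel G"
      unfolding subring_rel_def
    proof (intro conjI allI impI)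
      have "(of_rat 1, of_rat 1) \<in> G" unfolding G_def by blast
      then show "(1, 1) \<in> G" by simp
      fix x y u v assume "(x, y) \<in> G" "(u, v) \<in> G"
      then obtain p q where pq: "x = of_rat p" "y = of_rat p" "u = of_rat q" "v = of_rat q"
        unfolding G_def by blast
      have "(of_rat (p - q), of_rat (p - q)) \<in> G" "(of_rat (p * q), of_rat (p * q)) \<in> G"
        unfolding G_def by blast+
      then show "(x - u, y - v) \<in> G" "(x * u, y * v) \<in> G"
        unfolding pq of_rat_diff of_rat_mult by simp_all
    qed
    have Gnat: "(of_nat a, of_nat a) \<in> G" for a
    proof -
      have "(of_rat (of_nat a), of_rat (of_nat a)) \<in> G" unfolding G_def by blast
      then show ?thesis by simp
    qed
    have Ginv: "(1 / of_nat a, 1 / of_nat a) \<in> G" for a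
    proof -
      have "(of_rat (1 / of_nat a), of_rat (1 / of_nat a)) \<in> G" unfolding G_def by blast
      then show ?thesis by (simp add: of_rat_divide)
    qed
    have Gp: "subring_rel (poly_rel G)" using G by (rule subring_poly_rel)
    have lin: "([:- of_nat a, 1:], [:- of_nat a, 1:]) \<in> poly_rel G" for a
      by (intro poly_rel_pCons subring_rel_uminus[OF G] Gnat subring_rel_one[OF G] poly_rel_0[OF G])
    have "(spec_poly lam mu, pr) \<in> poly_rel G"
      unfolding spec_poly_def pr_def lam_def mu_def
      by (intro subring_rel_mult[OF Gp] subring_rel_prod[OF Gp] subring_rel_power[OF Gp] lin)
    then have coeffs: "(coeff (spec_poly lam mu) i, coeff pr i) \<in> G" for i unfolding poly_rel_def by blast
    \<comment> \<open>The integral from \<open>0\<close> to \<open>1\<close> as a rational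
      expression in the coefficients, valid in every field of characteristic zero.\<close>
    have eval: "poly Q 1 - poly Q 0 = of_nat (n + 1) * (\<Sum>i\<le>n. coeff q i * (1 / of_nat (Suc i)))"
      if Q: "pderiv Q = smult (of_nat (n + 1)) q" and q: "degree q = n" "lead_coeff q = 1"
      for Q q :: "'b::field_char_0 poly"
    proof -
      have degQ: "degree Q = Suc n" using degree_antiderivative(1)[OF Q q] by simp
      have "poly Q 1 = (\<Sum>i\<le>Suc n. coeff Q i)" unfolding poly_altdef degQ by simp
      also have "\<dots> = coeff Q 0 + (\<Sum>i\<le>n. coeff Q (Suc i))" by (rule sum.atMost_Suc_shift)
      also have "(\<Sum>i\<le>n. coeff Q (Suc i)) = (\<Sum>i\<le>n. of_nat (n + 1) * (coeff q i * (1 / of_nat (Suc i))))"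
      proof (intro sum.cong refl)
        fix i
        have "of_nat (Suc i) * coeff Q (Suc i) = of_nat (n + 1) * coeff q i"
          using arg_cong[OF Q, of "\<lambda>p. coeff p i"] unfolding coeff_pderiv by simp
        then show "coeff Q (Suc i) = of_nat (n + 1) * (coeff q i * (1 / of_nat (Suc i)))"
          by (simp add: field_simps del: of_nat_Suc)
      qed
      finally show ?thesis unfolding sum_distrib_left by (simp add: poly_0_coeff_0)
    qed
    have "(\<Sum>i\<le>n. coeff (spec_poly lam mu) i * (1 / of_nat (Suc i))) = 0"
      using eval[OF P degree_spec_poly] P01 by (simp del: of_nat_Suc)
    moreover have "(\<Sum>i\<le>n. coeff (spec_poly lam mu) i * (1 / of_nat (Suc i)),
        \<Sum>i\<le>n. coeff pr i * (1 / of_nat (Suc i))) \<in> G"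
      by (intro subring_rel_sum[OF G] subring_rel_mult[OF G] coeffs Ginv)
    ultimately have "(0, \<Sum>i\<le>n. coeff pr i * (1 / of_nat (Suc i))) \<in> G" by simp
    then have real0: "(\<Sum>i\<le>n. coeff pr i * (1 / of_nat (Suc i))) = 0" unfolding G_def by auto
    \<comment> \<open>A real antiderivative with equal values at \<open>0\<close> and
      \<open>1\<close> has a critical point strictly between them, where \<open>pr\<close> has no
      root.\<close>
    obtain Q where Q: "pderiv Q = smult (of_nat (n + 1)) pr" using exists_antiderivative by blast
    have "poly Q 1 - poly Q 0 = 0" using eval[OF Q[unfolded pr_def] degree_spec_poly] real0 unfolding pr_def by simp
    moreover obtain x where x: "0 < x" "x < 1" "poly Q 1 - poly Q 0 = (1 - 0) * poly (pderiv Q) x"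
      using poly_MVT[of 0 1 Q] by auto
    ultimately have "poly pr x = 0" unfolding Q by (simp del: of_nat_Suc)
    moreover have "poly [:- of_nat a, 1:] x \<noteq> 0" for a using x(1,2) by (cases a) auto
    ultimately show False
      unfolding pr_def spec_poly_def poly_mult poly_prod poly_power
      by (auto simp: prod_zero_iff simp del: poly_pCons of_nat_add)
  qed
  then show ?thesis using that B by blast
qed

end

section \<open>Classification by the number of eigenvalues with larger kernel\<close>

theorem theorem2p4:
  fixes emb :: "'a :: {alg_closed_field, field_char_0} \<Rightarrow> complex"
    and m k n M :: nat
    and \<alpha> \<beta> :: "nat \<Rightarrow> nat"
    and \<M> :: "'a mat set"
  assumes subfield: "field_hom emb"
    and alpha: "\<And>j. j \<in> {1..m} \<Longrightarrow> \<alpha> j \<ge> 2"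
    and beta: "\<And>i. i \<in> {1..k} \<Longrightarrow> \<beta> i \<ge> 1"
    and n: "n = (\<Sum>j=1..m. \<alpha> j) + (\<Sum>i=1..k. \<beta> i)"
    and M: "M = (\<Sum>j=1..m. \<alpha> j)"
    and Mclass: "\<M> = eigen_class n m \<alpha> k \<beta>"
  shows "(m \<le> 1 \<longrightarrow> (\<forall>B\<in>\<M>. integrable_mat n B)) \<and>
    (2 \<le> m \<and> m \<le> n - M + 1 \<longrightarrow>
       (\<exists>B\<in>\<M>. integrable_mat n B) \<and> (\<exists>B\<in>\<M>. \<not> integrable_mat n B)) \<and>
    (m > n - M + 1 \<longrightarrow> (\<forall>B\<in>\<M>. \<not> integrable_mat n B)) \<and>
    ((\<exists>B\<in>\<M>. integrable_mat n B) \<longleftrightarrow> m \<le> n - M + 1)"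
proof -
  interpret multiplicities m k n \<alpha> \<beta>
    by unfold_locales (use alpha beta n in auto)
  \<comment> \<open>The subtraction is not truncated, as \<open>M\<close> is one of the two summands
    of \<open>n\<close>.\<close>
  have nM: "n - M + 1 = (\<Sum>i=1..k. \<beta> i) + 1" unfolding n M by simp
  have mem: "B \<in> \<M> \<longleftrightarrow> (\<exists>lam mu. in_class B lam mu)" for B
    unfolding Mclass by (rule eigen_class_iff)
  have one: "integrable_mat n B" if "m \<le> 1" "B \<in> \<M>" for B
    using that integrable_if_at_most_one mem by blast
  have some: "\<exists>B\<in>\<M>. integrable_mat n B" if le: "m \<le> n - M + 1"
  proof -
    obtain B :: "'a mat" and lam mu where "in_class B lam mu" "integrable_mat n B"
      by (rule exists_integrable[OF subfield le[unfolded nM]])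
    then show ?thesis using mem by blast
  qed
  have non: "\<exists>B\<in>\<M>. \<not> integrable_mat n B" if "2 \<le> m"
    using exists_non_integrable[OF that] mem by metis
  have bound: "m \<le> n - M + 1" if B: "B \<in> \<M>" "integrable_mat n B" for B
  proof -
    obtain lam mu where "in_class B lam mu" using B(1) mem by blast
    then have "m + M \<le> n + 1" unfolding M using B(2) by (rule integrable_bound)
    then show ?thesis unfolding nM n M by simp
  qed
  show ?thesis
  proof (intro conjI impI)
    show "\<forall>B\<in>\<M>. integrable_mat n B" if "m \<le> 1" using one that by blast
    show "\<exists>B\<in>\<M>. integrable_mat n B" if "2 \<le> m \<and> m \<le> n - M + 1" using some that by blast
    show "\<exists>B\<in>\<M>. \<not> integrable_mat n B" if "2 \<le> m \<and> m \<le> n - M + 1" using non that by blast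
    show "\<forall>B\<in>\<M>. \<not> integrable_mat n B" if "m > n - M + 1" using bound that by (metis not_le)
    show "(\<exists>B\<in>\<M>. integrable_mat n B) \<longleftrightarrow> m \<le> n - M + 1" using bound some by blast
  qed
qed

end
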